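(* Fix $k\ge 3$ and $\varepsilon>0$, and let $n\ge\ell\ge k$. Let $\mathcal{I}=(\mathcal{H},\{(P_C,b_C)\}_{C\in\mathcal{H}})$ be a random one-basis $n$-qubit Hamiltonian $k$-XOR instance with $|\mathcal{H}|=\Theta(n)\cdot\left(\frac{n}{\ell}\right)^{k/2-1}\cdot\varepsilon^{-2}$ hyperedges. Then with probability $1-o(1)$ over the draw of $\mathcal{I}$: 1. $\lambda_{\max}(\mathbf{H}_{\mathcal{I}})\le\frac12+\varepsilon$; 2. The degree-$\tilde{\Omega}(\ell)$ non-commutative Sum-of-Squares relaxation fails to certify $\lambda_{\max}(\mathbf{H}_{\mathcal{I}})<1$; that is, there exists a degree-$D$ pseudo-expectation $\tilde{\mathbb{E}}$ with $D=\tilde\Omega(\ell)$ such that $\tilde{\mathbb{E}}[\mathbf{H}_{\mathcal{I}}]=1$.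
   Context: A Hamiltonian $k$-XOR instance $\mathcal{I}=(\mathcal{H},\{(P_C,b_C)\})$ consists of a $k$-uniform hypergraph $\mathcal{H}$ on $[n]$, for each $C\in\mathcal{H}$ an $n$-qubit Pauli operator $P_C\in\{\mathrm{Id},X,Y,Z\}^{\otimes n}$ acting non-trivially only on $C$, and a sign $b_C\in\{\pm1\}$; it defines $\mathbf{H}_{\mathcal{I}}=\frac{1}{|\mathcal{H}|}\sum_{C}\frac{\mathrm{Id}+b_CP_C}{2}$. A random one-basis instance with $m$ terms: $\mathcal{H}$ is a uniformly random $k$-uniform hypergraph on $[n]$ with $m$ hyperedges, the $b_C$ are independent uniform signs, and every $P_C=\sigma_C$ is the tensor product of a fixed single-qubit Pauli $\sigma\in\{X,Y,Z\}$ on the qubits of $C$ and identity elsewhere (e.g. $P_C=Z_C$). The degree (weight) of a Pauli string is the number of qubits on which it acts non-trivially; an operator has degree $\le d$ if its expansion in the Pauli basis involves only Pauli strings of weight $\le d$. A degree-$D$ pseudo-expectation is a linear functional $\tilde{\mathbb{E}}$ on operators of degree $\le D$ with $\tilde{\mathbb{E}}[\mathrm{Id}]=1$ and $\tilde{\mathbb{E}}[\mathbf{B}^\dagger\mathbf{B}]\ge0$ for every operator $\mathbf{B}$ of degree at most $D/2$. The degree-$D$ non-commutative Sum-of-Squares relaxation outputs $\max\tilde{\mathbb{E}}[\mathbf{H}]$ over such functionals; it certifies $\lambda_{\max}(\mathbf H)<1$ only if this maximum is $<1$. $\tilde\Omega(\ell)$ hides factors polylogarithmic in $n$ (and dependence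 on $\varepsilon$).
   Formalization: The constant in Θ(n) must exceed a threshold depending on k (item 1 fails for small ones), m is at most C(n,k), and the pseudo-expectation of value 1 is asserted only when D ≥ k, since otherwise H is outside its domain; for l up to polylog(n), e.g. k=l=4, D ≥ k can fail. *)

theory Defs
  imports
    "HOL-Probability.Probability"
    "HOL-Probability.Product_PMF"
    "Jordan_Normal_Form.Schur_Decomposition"
begin

section \<open>Pauli operators on \<open>n\<close> qubits\<close>

text \<open>
  Qubits are numbered \<open>0, \<dots>, n - 1\<close>, and an operator on \<open>n\<close> qubits is a complex
  \<open>2 ^ n \<times> 2 ^ n\<close> matrix.  A Pauli string is a list of length \<open>n\<close> whose \<open>i\<close>-th entry is the
  tensor factor on qubit \<open>i\<close>.
\<close>

datatype pauli = Pauli_I | Pauli_X | Pauli_Y | Pauli_Z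

fun pauli_mat :: "pauli \<Rightarrow> complex mat" where
  "pauli_mat Pauli_I = 1\<^sub>m 2"
| "pauli_mat Pauli_X = mat_of_rows_list 2 [[0, 1], [1, 0]]"
| "pauli_mat Pauli_Y = mat_of_rows_list 2 [[0, - \<i>], [\<i>, 0]]"
| "pauli_mat Pauli_Z = mat_of_rows_list 2 [[1, 0], [0, - 1]]"

definition kronecker :: "complex mat \<Rightarrow> complex mat \<Rightarrow> complex mat" where
  "kronecker A B = mat (dim_row A * dim_row B) (dim_col A * dim_col B)
     (\<lambda>(i, j). A $$ (i div dim_row B, j div dim_col B) * B $$ (i mod dim_row B, j mod dim_col B))"

fun pauli_op :: "pauli list \<Rightarrow> complex mat" where
  "pauli_op [] = 1\<^sub>m 1"
| "pauli_op (p # ps) = kronecker (pauli_mat p) (pauli_op ps)"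

definition pauli_strings :: "nat \<Rightarrow> pauli list set" where
  "pauli_strings n = {ps. length ps = n}"

definition pauli_support :: "pauli list \<Rightarrow> nat set" where
  "pauli_support ps = {i. i < length ps \<and> ps ! i \<noteq> Pauli_I}"

definition pauli_weight :: "pauli list \<Rightarrow> nat" where
  "pauli_weight ps = card (pauli_support ps)"

text \<open>The operator with Pauli coefficients \<open>c\<close>; the sum over Pauli strings is taken entrywise
  because matrices of unspecified dimension do not form a monoid.\<close>

definition pauli_expansion :: "nat \<Rightarrow> (pauli list \<Rightarrow> complex) \<Rightarrow> complex mat" where
  "pauli_expansion n c =
     mat (2 ^ n) (2 ^ n) (\<lambda>(i, j). \<Sum>ps\<in>pauli_strings n. c ps * pauli_op ps $$ (i, j))"

definition has_degree_le :: "nat \<Rightarrow> nat \<Rightarrow> complex mat \<Rightarrow> bool" where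
  "has_degree_le n d A \<longleftrightarrow>
     (\<exists>c. A = pauli_expansion n c \<and> (\<forall>ps\<in>pauli_strings n. c ps \<noteq> 0 \<longrightarrow> pauli_weight ps \<le> d))"

text \<open>Largest real eigenvalue; used for Hermitian matrices of positive dimension only.\<close>

definition lambda_max :: "complex mat \<Rightarrow> real" where
  "lambda_max A = Max {x :: real. eigenvalue A (complex_of_real x)}"


section \<open>Hamiltonian \<open>k\<close>-XOR\<close>

record kxor_instance =
  hyperedges :: "nat set set"
  pauli_at :: "nat set \<Rightarrow> pauli list"
  sign_at :: "nat set \<Rightarrow> real"

definition uniform_edges :: "nat \<Rightarrow> nat \<Rightarrow> nat set set" where
  "uniform_edges n k = {C. C \<subseteq> {0..<n} \<and> card C = k}"

definition hamiltonian_kxor :: "nat \<Rightarrow> nat \<Rightarrow> kxor_instance \<Rightarrow> bool" where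
  "hamiltonian_kxor n k I \<longleftrightarrow>
     hyperedges I \<subseteq> uniform_edges n k \<and>
     (\<forall>C\<in>hyperedges I. pauli_at I C \<in> pauli_strings n \<and> pauli_support (pauli_at I C) \<subseteq> C \<and>
        sign_at I C \<in> {1, - 1})"

definition kxor_hamiltonian :: "nat \<Rightarrow> kxor_instance \<Rightarrow> complex mat" where
  "kxor_hamiltonian n I =
     mat (2 ^ n) (2 ^ n) (\<lambda>(i, j).
       1 / of_nat (card (hyperedges I)) *
       (\<Sum>C\<in>hyperedges I.
          ((1\<^sub>m (2 ^ n) + complex_of_real (sign_at I C) \<cdot>\<^sub>m pauli_op (pauli_at I C)) $$ (i, j)) / 2))"

definition one_basis_string :: "nat \<Rightarrow> pauli \<Rightarrow> nat set \<Rightarrow> pauli list" where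
  "one_basis_string n \<sigma> C = map (\<lambda>i. if i \<in> C then \<sigma> else Pauli_I) [0..<n]"

text \<open>Random one-basis instance with \<open>m\<close> hyperedges.  The value is meaningful only for
  \<open>m \<le> n choose k\<close>: otherwise there is no such hypergraph, and \<^const>\<open>pmf_of_set\<close> is applied to
  the empty set.  Signs outside the hypergraph are set to the irrelevant default \<open>1\<close>.\<close>

definition random_one_basis :: "nat \<Rightarrow> nat \<Rightarrow> nat \<Rightarrow> pauli \<Rightarrow> kxor_instance pmf" where
  "random_one_basis n k m \<sigma> =
     do {
       E \<leftarrow> pmf_of_set {E. E \<subseteq> uniform_edges n k \<and> card E = m};
       b \<leftarrow> Pi_pmf E 1 (\<lambda>_. pmf_of_set {1, - 1});
       return_pmf \<lparr>hyperedges = E, pauli_at = one_basis_string n \<sigma>, sign_at = b\<rparr>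
     }"

lemma finite_uniform_edges: "finite (uniform_edges n k)"
  unfolding uniform_edges_def by (rule finite_subset[of _ "Pow {0..<n}"]) auto

lemma random_one_basis_is_instance:
  assumes "m \<le> n choose k" and "I \<in> set_pmf (random_one_basis n k m \<sigma>)"
  shows "hamiltonian_kxor n k I" and "card (hyperedges I) = m"
proof -
  have card: "card (uniform_edges n k) = n choose k"
    unfolding uniform_edges_def using n_subsets[of "{0..<n}" k] by simp
  let ?S = "{E. E \<subseteq> uniform_edges n k \<and> card E = m}"
  have fin: "finite ?S"
    by (rule finite_subset[of _ "Pow (uniform_edges n k)"]) (auto simp: finite_uniform_edges)
  have ne: "?S \<noteq> {}"
    using obtain_subset_with_card_n[of m "uniform_edges n k"] assms(1) card by auto
  obtain E b where E: "E \<subseteq> uniform_edges n k" "card E = m"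
    and b: "b \<in> set_pmf (Pi_pmf E 1 (\<lambda>_. pmf_of_set {1, - 1 :: real}))"
    and I: "I = \<lparr>hyperedges = E, pauli_at = one_basis_string n \<sigma>, sign_at = b\<rparr>"
    using assms(2) unfolding random_one_basis_def
    by (auto simp: set_pmf_of_set[OF ne fin])
  have "finite E"
    using E(1) finite_uniform_edges finite_subset by blast
  hence "b C \<in> {1, - 1}" if "C \<in> E" for C
    using b that by (auto simp: set_Pi_pmf PiE_dflt_def)
  thus "hamiltonian_kxor n k I" "card (hyperedges I) = m"
    using E I
    by (auto simp: hamiltonian_kxor_def one_basis_string_def pauli_strings_def pauli_support_def
        split: if_splits)
qed


section \<open>The non-commutative Sum-of-Squares relaxation\<close>

text \<open>
  A functional on the operators of degree at most \<open>D\<close> is represented by a total function on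
  matrices, whose values outside this domain carry no meaning.  The order on \<^typ>\<open>complex\<close> is that
  of \<open>Complex_Order\<close>, so \<open>0 \<le> z\<close> says that \<open>z\<close> is real and nonnegative.
\<close>

definition pseudo_expectation :: "nat \<Rightarrow> nat \<Rightarrow> (complex mat \<Rightarrow> complex) \<Rightarrow> bool" where
  "pseudo_expectation n D E \<longleftrightarrow>
     (\<forall>A B. has_degree_le n D A \<longrightarrow> has_degree_le n D B \<longrightarrow> E (A + B) = E A + E B) \<and>
     (\<forall>a A. has_degree_le n D A \<longrightarrow> E (a \<cdot>\<^sub>m A) = a * E A) \<and>
     E (1\<^sub>m (2 ^ n)) = 1 \<and>
     (\<forall>d B. 2 * d \<le> D \<longrightarrow> has_degree_le n d B \<longrightarrow> 0 \<le> E (mat_adjoint B * B))"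

definition ncsos_value :: "nat \<Rightarrow> nat \<Rightarrow> complex mat \<Rightarrow> ereal" where
  "ncsos_value n D H = (SUP E\<in>{E. pseudo_expectation n D E}. ereal (Re (E H)))"

text \<open>The relaxation applies to \<open>H\<close> only if \<open>H\<close> lies in the domain of the degree-\<open>D\<close>
  pseudo-expectations.\<close>

definition ncsos_certifies_less :: "nat \<Rightarrow> nat \<Rightarrow> complex mat \<Rightarrow> ereal \<Rightarrow> bool" where
  "ncsos_certifies_less n D H v \<longleftrightarrow> has_degree_le n D H \<and> ncsos_value n D H < v"

end

theory Submission
  imports Defs "HOL-Real_Asymp.Real_Asymp"
begin

text \<open>
  A one-basis Hamiltonian is diagonalised by a tensor power of the eigenbasis of \<open>\<sigma>\<close>, with the values
  of a classical random \<open>k\<close>-XOR instance on the diagonal, so Hoeffding's inequality and a union bound over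
  the \<open>2 ^ n\<close> basis vectors bound its largest eigenvalue.

  For the lower bound, a first moment computation shows that with high probability every nonempty set
  \<open>T\<close> of at most \<open>r = l / ln n\<close> hyperedges covers more than \<open>card T * (k / 2 + 1 / (2 * ln n))\<close>
  vertices, so that more than \<open>card T / ln n\<close> of them have odd degree in \<open>T\<close>.  Following Grigoriev
  and Schoenebeck, give \<open>\<sigma>\<^sub>S\<close> the value \<open>\<Prod>C\<in>T. b C\<close> if \<open>S\<close> is the odd-degree set of some \<open>T\<close> with
  \<open>2 * card T \<le> r\<close>, and give every other Pauli string the value \<open>0\<close>.  Expansion makes this well defined and
  multiplicative on sets of size at most \<open>D = r / (2 * ln n)\<close>: a product of two derivations has at most \<open>r\<close>
  hyperedges, and if it had more than \<open>r / 2\<close>, its odd-degree set would be larger than \<open>D\<close>.  Modulo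
  phases, a Pauli string is a product of a \<open>\<sigma>\<close>-part and a part in a complementary basis;
  strings with different complementary parts do not interact, and within each class the moment matrix
  splits into blocks of rank one, hence it is positive semidefinite.
\<close>

section \<open>Hypergraph expansion\<close>

text \<open>For finite \<open>T\<close> this is the sum over the two-element field of the indicator
  vectors of the hyperedges, hence the support of the product of the strings \<sigma>_C with
  \<open>C\<close> in \<open>T\<close>.\<close>

definition odd_vertices :: "nat set set \<Rightarrow> nat set" where
  "odd_vertices T = {i. odd (card {C\<in>T. i \<in> C})}"

lemma odd_card_sym_diff:
  assumes "finite A" "finite B"
  shows "odd (card (sym_diff A B)) \<longleftrightarrow> odd (card A) \<noteq> odd (card B)"
proof -
  have 1: "card (sym_diff A B) = card (A - B) + card (B - A)"
    using assms by (intro card_Un_disjoint) auto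
  have 2: "card A = card (A - B) + card (A \<inter> B)" "card B = card (B - A) + card (A \<inter> B)"
    using assms by (metis add.commute card_Int_Diff, metis Int_commute add.commute card_Int_Diff)
  show ?thesis unfolding 1 2 by auto
qed

lemma card_sym_diff_le: "card (sym_diff A B) \<le> card A + card B" if "finite A" "finite B"
proof -
  have "card (sym_diff A B) \<le> card (A \<union> B)" using that by (intro card_mono) auto
  also have "\<dots> \<le> card A + card B" by (rule card_Un_le)
  finally show ?thesis .
qed

text \<open>Linearity over the two-element field: hyperedges in both sets are counted twice and
  cancel modulo 2.\<close>

lemma odd_vertices_sym_diff:
  assumes "finite T" "finite T'"
  shows "odd_vertices (sym_diff T T') = sym_diff (odd_vertices T) (odd_vertices T')"
proof -
  have "{C\<in>sym_diff T T'. i \<in> C} = sym_diff {C\<in>T. i \<in> C} {C\<in>T'. i \<in> C}" for i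
    by auto
  thus ?thesis
    using assms by (auto simp: odd_vertices_def odd_card_sym_diff)
qed

lemma odd_vertices_empty [simp]: "odd_vertices {} = {}"
  by (simp add: odd_vertices_def)

lemma odd_vertices_singleton [simp]: "odd_vertices {C} = C"
proof -
  have "{D\<in>{C}. i \<in> D} = (if i \<in> C then {C} else {})" for i by auto
  thus ?thesis by (auto simp: odd_vertices_def)
qed

lemma odd_vertices_subset: "odd_vertices T \<subseteq> \<Union>T"
proof
  fix i assume "i \<in> odd_vertices T"
  hence "{C\<in>T. i \<in> C} \<noteq> {}" by (auto simp: odd_vertices_def simp del: Collect_empty_eq)
  thus "i \<in> \<Union>T" by auto
qed

text \<open>Double counting of incidences. The degrees sum to \<open>k * card T\<close>; a covered
  vertex of even degree contributes at least 2 to this sum and one of odd degree at least 1.\<close>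

lemma card_odd_vertices_ge:
  assumes "finite T" "\<And>C. C \<in> T \<Longrightarrow> finite C \<and> card C = k"
  shows "2 * card (\<Union>T) \<le> k * card T + card (odd_vertices T)"
proof -
  let ?U = "\<Union>T" let ?O = "odd_vertices T"
  have fU: "finite ?U" using assms by auto
  have OU: "?O \<subseteq> ?U" by (rule odd_vertices_subset)
  have fO: "finite ?O" using OU fU finite_subset by blast
  have deg: "2 \<le> card {C\<in>T. i \<in> C}" if "i \<in> ?U - ?O" for i
  proof -
    have "card {C\<in>T. i \<in> C} \<noteq> 0" using that assms(1) by auto
    moreover have "even (card {C\<in>T. i \<in> C})" using that by (auto simp: odd_vertices_def)
    ultimately show ?thesis by presburger
  qed
  have deg1: "1 \<le> card {C\<in>T. i \<in> C}" if "i \<in> ?O" for i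
    using that by (auto simp: odd_vertices_def intro!: Suc_leI odd_pos)
  have "(\<Sum>i\<in>?U. card {C\<in>T. i \<in> C}) = (\<Sum>C\<in>T. card {i\<in>?U. i \<in> C})"
    using sum.swap_restrict[OF fU assms(1), of "\<lambda>_ _. 1::nat" "\<lambda>i C. i \<in> C"] by simp
  also have "\<dots> = (\<Sum>C\<in>T. k)"
  proof (rule sum.cong[OF refl])
    fix C assume "C \<in> T"
    hence "{i\<in>?U. i \<in> C} = C" by auto
    thus "card {i\<in>?U. i \<in> C} = k" using assms \<open>C \<in> T\<close> by simp
  qed
  finally have total: "(\<Sum>i\<in>?U. card {C\<in>T. i \<in> C}) = k * card T" by simp
  have "(\<Sum>i\<in>?U. card {C\<in>T. i \<in> C}) =
      (\<Sum>i\<in>?U - ?O. card {C\<in>T. i \<in> C}) + (\<Sum>i\<in>?O. card {C\<in>T. i \<in> C})"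
    by (rule sum.subset_diff[OF OU fU])
  moreover have "(\<Sum>i\<in>?U - ?O. card {C\<in>T. i \<in> C}) \<ge> card (?U - ?O) * 2"
    using sum_mono[OF deg] by (simp only: sum_constant of_nat_id)
  moreover have "(\<Sum>i\<in>?O. card {C\<in>T. i \<in> C}) \<ge> card ?O * 1"
    using sum_mono[OF deg1] by (simp only: sum_constant of_nat_id)
  moreover have "card (?U - ?O) = card ?U - card ?O" "card ?O \<le> card ?U"
    using OU fU fO by (auto intro: card_Diff_subset card_mono)
  ultimately show ?thesis using total by linarith
qed

text \<open>The two expansion properties under which XOR-ing at most \<open>r div 2\<close> constraints derives
  consistent signs for parities of at most \<open>D\<close> variables.\<close>

definition expanding :: "nat set set \<Rightarrow> nat \<Rightarrow> nat \<Rightarrow> bool" where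
  "expanding E r D \<longleftrightarrow> finite E \<and> 2 \<le> r \<and>
     (\<forall>T\<subseteq>E. T \<noteq> {} \<longrightarrow> card T \<le> r \<longrightarrow> odd_vertices T \<noteq> {}) \<and>
     (\<forall>T\<subseteq>E. card T \<le> r \<longrightarrow> r < 2 * card T \<longrightarrow> D < card (odd_vertices T))"

text \<open>By the double count, covering more than \<open>k / 2 + \<eta>\<close> vertices per
  hyperedge leaves more than \<open>2 * card T * \<eta>\<close> vertices of odd degree. This is
  positive for nonempty \<open>T\<close>, and exceeds \<open>r * \<eta>\<close> as soon as
  \<open>2 * card T\<close> exceeds \<open>r\<close>.\<close>

lemma expandingI:
  assumes "finite E" and uniform: "\<And>C. C \<in> E \<Longrightarrow> finite C \<and> card C = k" and "2 \<le> r"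
    and "0 \<le> \<eta>" "real D \<le> real r * \<eta>"
    and large: "\<And>T. T \<subseteq> E \<Longrightarrow> T \<noteq> {} \<Longrightarrow> card T \<le> r \<Longrightarrow>
       real (card T) * (real k / 2 + \<eta>) < real (card (\<Union>T))"
  shows "expanding E r D"
proof -
  have odd: "2 * real (card T) * \<eta> < real (card (odd_vertices T))"
    if T: "T \<subseteq> E" "T \<noteq> {}" "card T \<le> r" for T
  proof -
    have "finite T" using T \<open>finite E\<close> finite_subset by blast
    hence "2 * card (\<Union>T) \<le> k * card T + card (odd_vertices T)"
      using T uniform by (intro card_odd_vertices_ge) auto
    hence "real (2 * card (\<Union>T)) \<le> real (k * card T + card (odd_vertices T))"
      by (rule of_nat_mono)
    thus ?thesis using large[OF T] by (simp add: algebra_simps)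
  qed
  show ?thesis unfolding expanding_def
  proof (intro conjI allI impI)
    fix T assume T: "T \<subseteq> E" "T \<noteq> {}" "card T \<le> r"
    have "0 \<le> 2 * real (card T) * \<eta>" using \<open>0 \<le> \<eta>\<close> by simp
    thus "odd_vertices T \<noteq> {}" using odd[OF T] by (metis card.empty not_less of_nat_0)
  next
    fix T assume T: "T \<subseteq> E" "card T \<le> r" "r < 2 * card T"
    have "T \<noteq> {}" using T by auto
    have "real D \<le> real r * \<eta>" by fact
    also have "\<dots> \<le> (2 * real (card T)) * \<eta>"
      using T \<open>0 \<le> \<eta>\<close> by (intro mult_right_mono) auto
    also have "\<dots> < real (card (odd_vertices T))"
      by (rule odd[OF T(1) \<open>T \<noteq> {}\<close> T(2)])
    finally show "D < card (odd_vertices T)" by simp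
  qed (use assms in auto)
qed

text \<open>No randomness enters: two distinct sets of equal size each contain a point outside the
  other, so their symmetric difference has at least two elements. This covers the range of small
  \<open>l\<close>, where degree 1 meets the required bound.\<close>

lemma expanding_2_1:
  assumes "finite E" and uniform: "\<And>C. C \<in> E \<Longrightarrow> finite C \<and> card C = k" and "2 \<le> k"
  shows "expanding E 2 1"
proof -
  have pair: "1 < card (odd_vertices T)" if T: "T \<subseteq> E" "card T = 2" for T
  proof -
    obtain C C' where C: "T = {C, C'}" "C \<noteq> C'" using T(2) card_2_iff by metis
    have "T = sym_diff {C} {C'}" using C by auto
    hence eq: "odd_vertices T = sym_diff C C'"
      using odd_vertices_sym_diff[of "{C}" "{C'}"] by simp
    have fin: "finite C" "finite C'" "card C = card C'" using uniform T C by auto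
    have "C - C' \<noteq> {}" "C' - C \<noteq> {}"
      using fin C(2) by (metis Diff_eq_empty_iff card_subset_eq)+
    hence "card (C - C') > 0" "card (C' - C) > 0" using fin by (auto simp: card_gt_0_iff)
    moreover have "card (sym_diff C C') = card (C - C') + card (C' - C)"
      using fin by (intro card_Un_disjoint) auto
    ultimately show ?thesis using eq by simp
  qed
  have single: "odd_vertices T \<noteq> {}" if T: "T \<subseteq> E" "card T = 1" for T
  proof -
    obtain C where "T = {C}" using T(2) card_1_singletonE by blast
    thus ?thesis using uniform[of C] T assms(3) by auto
  qed
  show ?thesis unfolding expanding_def
  proof (intro conjI allI impI)
    fix T assume T: "T \<subseteq> E" "T \<noteq> {}" "card T \<le> 2"
    moreover have "finite T" using T(1) \<open>finite E\<close> by (rule finite_subset)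
    ultimately have "card T \<noteq> 0" by simp
    with T(3) have "card T = 1 \<or> card T = 2" by arith
    thus "odd_vertices T \<noteq> {}"
      using single[OF T(1)] pair[OF T(1)] by (metis card.empty not_one_less_zero)
  next
    fix T assume T: "T \<subseteq> E" "card T \<le> 2" "2 < 2 * card T"
    thus "1 < card (odd_vertices T)" by (intro pair) auto
  qed (use assms in auto)
qed

section \<open>Derived signs\<close>

text \<open>Common hyperedges occur twice on the right, and their signs square to 1.\<close>

lemma prod_sign_sym_diff:
  fixes b :: "'a \<Rightarrow> 'b::comm_ring_1"
  assumes "finite T" "finite T'" "\<And>C. C \<in> T \<union> T' \<Longrightarrow> b C * b C = 1"
  shows "prod b (sym_diff T T') = prod b T * prod b T'"
proof -
  have 1: "prod b (sym_diff T T') = prod b (T - T') * prod b (T' - T)"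
    using assms by (intro prod.union_disjoint) auto
  have 2: "prod b T = prod b (T - T') * prod b (T \<inter> T')"
    using assms by (metis prod.Int_Diff mult.commute)
  have 3: "prod b T' = prod b (T' - T) * prod b (T \<inter> T')"
    using assms by (metis prod.Int_Diff mult.commute Int_commute)
  have "prod b (T \<inter> T') * prod b (T \<inter> T') = 1"
    unfolding prod.distrib[symmetric] using assms by (intro prod.neutral) auto
  thus ?thesis unfolding 1 2 3 by (simp add: algebra_simps)
qed

text \<open>The size limit is half the expansion range \<open>r\<close>, so that the symmetric
  difference of two derivations still lies within that range.\<close>

definition derivable :: "nat set set \<Rightarrow> nat \<Rightarrow> nat set \<Rightarrow> nat set set \<Rightarrow> bool" where
  "derivable E r S T \<longleftrightarrow> T \<subseteq> E \<and> 2 * card T \<le> r \<and> odd_vertices T = S"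

text \<open>Under expansion the derivation is unique, so the choice by \<open>SOME\<close> is
  harmless. The value 0 marks a parity about which the constraints derive nothing.\<close>

definition derived_sign :: "nat set set \<Rightarrow> (nat set \<Rightarrow> real) \<Rightarrow> nat \<Rightarrow> nat set \<Rightarrow> real" where
  "derived_sign E b r S =
     (if \<exists>T. derivable E r S T then prod b (SOME T. derivable E r S T) else 0)"

context
  fixes E :: "nat set set" and b :: "nat set \<Rightarrow> real" and r D :: nat
  assumes E: "expanding E r D" and b: "\<And>C. C \<in> E \<Longrightarrow> b C \<in> {1, - 1}"
begin

lemma derivable_finite: "derivable E r S T \<Longrightarrow> finite T"
  using E unfolding derivable_def expanding_def by (blast intro: finite_subset)

text \<open>The symmetric difference of two derivations of \<open>S\<close> lies within the
  expansion range and has no vertex of odd degree, so it must be empty.\<close>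

lemma derivable_unique:
  assumes T: "derivable E r S T" and T': "derivable E r S T'"
  shows "T = T'"
proof (rule ccontr)
  assume "T \<noteq> T'"
  have fin: "finite T" "finite T'"
    using T T' by (auto dest: derivable_finite)
  have "card (sym_diff T T') \<le> card T + card T'"
    using fin by (rule card_sym_diff_le)
  also have "\<dots> \<le> r" using T T' by (simp add: derivable_def)
  finally have "card (sym_diff T T') \<le> r" .
  moreover have "sym_diff T T' \<noteq> {}" using \<open>T \<noteq> T'\<close> by auto
  moreover have "sym_diff T T' \<subseteq> E" using T T' by (auto simp: derivable_def)
  ultimately have "odd_vertices (sym_diff T T') \<noteq> {}" using E unfolding expanding_def by blast
  thus False using T T' odd_vertices_sym_diff[OF fin] by (simp add: derivable_def)
qed

lemma derived_sign_eq: "derivable E r S T \<Longrightarrow> derived_sign E b r S = prod b T"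
  unfolding derived_sign_def by (metis derivable_unique someI)

lemma derived_sign_empty: "derived_sign E b r {} = 1"
  using derived_sign_eq[of "{}" "{}"] by (simp add: derivable_def)

text \<open>The constraint \<open>C\<close> alone is a derivation of \<open>C\<close>; the condition
  \<open>2 \<le> r\<close> in \<open>expanding\<close> makes it short enough.\<close>

lemma derived_sign_edge:
  assumes "C \<in> E"
  shows "derived_sign E b r C = b C"
  using derived_sign_eq[of C "{C}"] assms E by (simp add: derivable_def expanding_def)

text \<open>The symmetric difference of the two derivations has the right odd-degree set and at most
  \<open>r\<close> hyperedges. It is again short enough to count as a derivation, because more than
  \<open>r / 2\<close> hyperedges would leave more than \<open>D\<close> odd vertices.\<close>

lemma derived_sign_sym_diff:
  assumes "derived_sign E b r A \<noteq> 0" "derived_sign E b r B \<noteq> 0" "card (sym_diff A B) \<le> D"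
  shows "derived_sign E b r (sym_diff A B) = derived_sign E b r A * derived_sign E b r B"
proof -
  obtain T T' where T: "derivable E r A T" and T': "derivable E r B T'"
    using assms by (auto simp: derived_sign_def split: if_splits)
  have fin: "finite T" "finite T'"
    using T T' by (auto dest: derivable_finite)
  have "card (sym_diff T T') \<le> card T + card T'"
    using fin by (rule card_sym_diff_le)
  also have "\<dots> \<le> r" using T T' by (simp add: derivable_def)
  finally have le: "card (sym_diff T T') \<le> r" .
  have sub: "sym_diff T T' \<subseteq> E" using T T' by (auto simp: derivable_def)
  have odd: "odd_vertices (sym_diff T T') = sym_diff A B"
    using T T' odd_vertices_sym_diff[OF fin] by (simp add: derivable_def)
  have "2 * card (sym_diff T T') \<le> r"
  proof (rule ccontr)
    assume "\<not> 2 * card (sym_diff T T') \<le> r"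
    hence "D < card (odd_vertices (sym_diff T T'))"
      using E sub le unfolding expanding_def by auto
    thus False using odd assms(3) by simp
  qed
  hence "derivable E r (sym_diff A B) (sym_diff T T')"
    using sub odd by (simp add: derivable_def)
  hence "derived_sign E b r (sym_diff A B) = prod b (sym_diff T T')" by (rule derived_sign_eq)
  also have "\<dots> = prod b T * prod b T'"
  proof (rule prod_sign_sym_diff[OF fin])
    fix C assume "C \<in> T \<union> T'"
    hence "C \<in> E" using T T' by (auto simp: derivable_def)
    thus "b C * b C = 1" using b by fastforce
  qed
  finally show ?thesis using derived_sign_eq[OF T] derived_sign_eq[OF T'] by simp
qed

end

section \<open>Positivity of kernels with rank-one blocks\<close>

text \<open>Being nonzero under \<open>K\<close> is an equivalence relation, and on each class
  \<open>K\<close> is a rank-one matrix with entries 1 and -1. Hence the square of \<open>K\<close>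
  is \<open>K\<close> scaled by the class size, and rescaling the coefficients turns the form into a
  sum of squared moduli.\<close>

lemma block_kernel_psd:
  fixes K :: "'a \<Rightarrow> 'a \<Rightarrow> real" and c :: "'a \<Rightarrow> complex"
  assumes fin: "finite X"
    and one: "\<And>p. p \<in> X \<Longrightarrow> K p p = 1"
    and sym: "\<And>p q. p \<in> X \<Longrightarrow> q \<in> X \<Longrightarrow> K p q = K q p"
    and trans: "\<And>p q s. p \<in> X \<Longrightarrow> q \<in> X \<Longrightarrow> s \<in> X \<Longrightarrow> K p q \<noteq> 0 \<Longrightarrow> K q s \<noteq> 0 \<Longrightarrow> K p s = K p q * K q s"
  shows "0 \<le> (\<Sum>p\<in>X. \<Sum>q\<in>X. cnj (c p) * c q * of_real (K p q))"
proof -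
  define cls where "cls p = {q\<in>X. K p q \<noteq> 0}" for p
  define N where "N p = real (card (cls p))" for p
  \<comment> \<open>The class size \<open>N\<close> is constant on each class, so two factors of
    this form absorb exactly one factor \<open>N p\<close>.\<close>
  define e where "e p = c p / of_real (sqrt (N p))" for p
  have cls: "cls p = cls q" if "p \<in> X" "q \<in> X" "K p q \<noteq> 0" for p q
  proof -
    have "K q p \<noteq> 0" using that(3) sym[OF that(1,2)] by simp
    have "K p s \<noteq> 0 \<longleftrightarrow> K q s \<noteq> 0" if "s \<in> X" for s
      using trans[OF \<open>p \<in> X\<close> \<open>q \<in> X\<close> that \<open>K p q \<noteq> 0\<close>]
        trans[OF \<open>q \<in> X\<close> \<open>p \<in> X\<close> that \<open>K q p \<noteq> 0\<close>] \<open>K p q \<noteq> 0\<close> \<open>K q p \<noteq> 0\<close>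
      by (metis mult_eq_0_iff)
    thus ?thesis by (auto simp: cls_def)
  qed
  have Npos: "N p > 0" if "p \<in> X" for p
    using that one[OF that] fin by (auto simp: N_def cls_def card_gt_0_iff)
  \<comment> \<open>For \<open>s\<close> in the class of \<open>p\<close> the summand equals
    \<open>K p s * K s q = K p q\<close>; for all other \<open>s\<close> it vanishes.\<close>
  have KK: "(\<Sum>s\<in>X. K s p * K s q) = N p * K p q" if "p \<in> X" "q \<in> X" for p q
  proof -
    have "(\<Sum>s\<in>X. K s p * K s q) = (\<Sum>s\<in>X. if s \<in> cls p then K p q else 0)"
    proof (intro sum.cong refl)
      fix s assume s: "s \<in> X"
      show "K s p * K s q = (if s \<in> cls p then K p q else 0)"
      proof (cases "K s p = 0")
        case True
        thus ?thesis using s sym[OF that(1) s] by (simp add: cls_def)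
      next
        case False
        have ps: "K p s \<noteq> 0" using False sym[OF that(1) s] by simp
        have "K p q = K p s * K s q"
        proof (cases "K s q = 0")
          case True
          have "K p q = 0"
            using trans[OF s that False] True False by (metis mult_eq_0_iff)
          thus ?thesis using True by simp
        qed (use trans[OF that(1) s that(2) ps] in simp)
        thus ?thesis using ps s sym[OF that(1) s] by (simp add: cls_def)
      qed
    qed
    also have "\<dots> = (\<Sum>s\<in>cls p. K p q)"
      using fin by (subst sum.inter_restrict[symmetric]) (auto simp: cls_def Int_def intro!: sum.cong)
    finally show ?thesis by (simp add: N_def)
  qed
  have "(\<Sum>p\<in>X. \<Sum>q\<in>X. cnj (c p) * c q * of_real (K p q)) =
      (\<Sum>p\<in>X. \<Sum>q\<in>X. cnj (e p) * e q * of_real (\<Sum>s\<in>X. K s p * K s q))"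
  proof (intro sum.cong refl)
    fix p q assume pq: "p \<in> X" "q \<in> X"
    show "cnj (c p) * c q * of_real (K p q) = cnj (e p) * e q * of_real (\<Sum>s\<in>X. K s p * K s q)"
    proof (cases "K p q = 0")
      case True
      thus ?thesis by (simp add: KK[OF pq])
    next
      case False
      have "N q = N p" using cls[OF pq False] by (simp add: N_def)
      moreover have "of_real (sqrt (N p)) * of_real (sqrt (N p)) = (of_real (N p) :: complex)"
        using Npos[OF pq(1)] by (simp flip: of_real_mult)
      ultimately show ?thesis
        using Npos[OF pq(1)] by (simp add: KK[OF pq] e_def field_simps)
    qed
  qed
  also have "\<dots> = (\<Sum>p\<in>X. \<Sum>q\<in>X. \<Sum>s\<in>X. cnj (e p * of_real (K s p)) * (e q * of_real (K s q)))"
    by (intro sum.cong refl) (simp add: sum_distrib_left mult_ac)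
  also have "\<dots> = (\<Sum>p\<in>X. \<Sum>s\<in>X. \<Sum>q\<in>X. cnj (e p * of_real (K s p)) * (e q * of_real (K s q)))"
    by (intro sum.cong refl sum.swap)
  also have "\<dots> = (\<Sum>s\<in>X. \<Sum>p\<in>X. \<Sum>q\<in>X. cnj (e p * of_real (K s p)) * (e q * of_real (K s q)))"
    by (rule sum.swap)
  also have "\<dots> = (\<Sum>s\<in>X. cnj (\<Sum>p\<in>X. e p * of_real (K s p)) * (\<Sum>p\<in>X. e p * of_real (K s p)))"
    by (simp only: sum_product cnj_sum)
  also have "\<dots> = (\<Sum>s\<in>X. of_real ((cmod (\<Sum>p\<in>X. e p * of_real (K s p)))\<^sup>2))"
    by (intro sum.cong refl) (simp only: complex_norm_square mult.commute)
  also have "0 \<le> \<dots>" by (intro sum_nonneg) (simp add: less_eq_complex_def)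
  finally show ?thesis .
qed

section \<open>Traces of products of Pauli strings\<close>

lemma pauli_mat_dim [simp]: "dim_row (pauli_mat p) = 2" "dim_col (pauli_mat p) = 2"
  by (cases p; simp add: mat_of_rows_list_def)+

lemma pauli_mat_entries [simp]:
  "pauli_mat Pauli_I $$ (0, 0) = 1" "pauli_mat Pauli_I $$ (0, Suc 0) = 0"
  "pauli_mat Pauli_I $$ (Suc 0, 0) = 0" "pauli_mat Pauli_I $$ (Suc 0, Suc 0) = 1"
  "pauli_mat Pauli_X $$ (0, 0) = 0" "pauli_mat Pauli_X $$ (0, Suc 0) = 1"
  "pauli_mat Pauli_X $$ (Suc 0, 0) = 1" "pauli_mat Pauli_X $$ (Suc 0, Suc 0) = 0"
  "pauli_mat Pauli_Y $$ (0, 0) = 0" "pauli_mat Pauli_Y $$ (0, Suc 0) = - \<i>"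
  "pauli_mat Pauli_Y $$ (Suc 0, 0) = \<i>" "pauli_mat Pauli_Y $$ (Suc 0, Suc 0) = 0"
  "pauli_mat Pauli_Z $$ (0, 0) = 1" "pauli_mat Pauli_Z $$ (0, Suc 0) = 0"
  "pauli_mat Pauli_Z $$ (Suc 0, 0) = 0" "pauli_mat Pauli_Z $$ (Suc 0, Suc 0) = - 1"
  by (simp_all add: mat_of_rows_list_def)

lemma kronecker_dim [simp]:
  "dim_row (kronecker A B) = dim_row A * dim_row B"
  "dim_col (kronecker A B) = dim_col A * dim_col B"
  by (simp_all add: kronecker_def)

lemma mult_add_less: "a * r + i < m * r" if "a < m" "i < r" for a i m r :: nat
proof -
  have "a * r + i < Suc a * r" using that by simp
  also have "\<dots> \<le> m * r" using that by (intro mult_right_mono) auto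
  finally show ?thesis .
qed

lemma kronecker_index:
  assumes "a < dim_row A" "b < dim_col A" "i < dim_row B" "j < dim_col B"
  shows "kronecker A B $$ (a * dim_row B + i, b * dim_col B + j) = A $$ (a, b) * B $$ (i, j)"
  using assms by (simp add: kronecker_def mult_add_less)

lemma pauli_op_dim [simp]:
  "dim_row (pauli_op ps) = 2 ^ length ps" "dim_col (pauli_op ps) = 2 ^ length ps"
  by (induction ps) auto

lemma pauli_op_Cons_index:
  assumes "a < 2" "b < 2" "i < 2 ^ length ps" "j < 2 ^ length ps"
  shows "pauli_op (p # ps) $$ (a * 2 ^ length ps + i, b * 2 ^ length ps + j) =
    pauli_mat p $$ (a, b) * pauli_op ps $$ (i, j)"
  using kronecker_index[of a "pauli_mat p" b i "pauli_op ps" j] assms by simp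

lemma sum_mult_split:
  fixes f :: "nat \<Rightarrow> 'a::comm_monoid_add"
  shows "sum f {..<m * r} = (\<Sum>a<m. \<Sum>i<r. f (a * r + i))"
proof -
  have "sum f {..<m * r} = (\<Sum>a<m. sum f {a * r..<a * r + r})"
    by (rule sum.nat_group[symmetric])
  also have "\<dots> = (\<Sum>a<m. \<Sum>i<r. f (a * r + i))"
  proof (rule sum.cong[OF refl])
    show "sum f {a * r..<a * r + r} = (\<Sum>i<r. f (a * r + i))" for a
      using sum.shift_bounds_nat_ivl[of f 0 "a * r" r] by (simp add: lessThan_atLeast0 add.commute)
  qed
  finally show ?thesis .
qed

lemma sum_qubit_split:
  fixes f :: "nat \<Rightarrow> 'a::comm_monoid_add"
  shows "sum f {..<2 ^ Suc n} = (\<Sum>a<2. \<Sum>i<2 ^ n. f (a * 2 ^ n + i))"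
  unfolding power_Suc by (rule sum_mult_split)

text \<open>For square matrices of size \<open>N\<close> this is the trace of \<open>A\<close> times
  the adjoint of \<open>B\<close> times \<open>C\<close>. It is written in entries so that it
  factors over the qubits once the indices are split.\<close>

definition trace3 :: "nat \<Rightarrow> complex mat \<Rightarrow> complex mat \<Rightarrow> complex mat \<Rightarrow> complex" where
  "trace3 N A B C = (\<Sum>i<N. \<Sum>j<N. \<Sum>k<N. A $$ (i, j) * cnj (B $$ (k, j)) * C $$ (k, i))"

text \<open>Each index splits into the bit of the first qubit and an index for the others; the
  entries factor accordingly, so the sixfold sum is a product of two traces.\<close>

lemma trace3_pauli_Cons:
  assumes "length ss = n" "length ps = n" "length qs = n"
  shows "trace3 (2 ^ Suc n) (pauli_op (s # ss)) (pauli_op (p # ps)) (pauli_op (q # qs)) =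
    trace3 2 (pauli_mat s) (pauli_mat p) (pauli_mat q) *
    trace3 (2 ^ n) (pauli_op ss) (pauli_op ps) (pauli_op qs)"
proof -
  have idx: "pauli_op (r # rs) $$ (a * 2 ^ n + i, b * 2 ^ n + j) = pauli_mat r $$ (a, b) * pauli_op rs $$ (i, j)"
    if "length rs = n" "a < 2" "b < 2" "i < 2 ^ n" "j < 2 ^ n" for r rs a b i j
    using pauli_op_Cons_index[of a b i rs j r] that by simp
  have "trace3 (2 ^ Suc n) (pauli_op (s # ss)) (pauli_op (p # ps)) (pauli_op (q # qs)) =
    (\<Sum>a<2. \<Sum>i<2 ^ n. \<Sum>b<2. \<Sum>j<2 ^ n. \<Sum>c<2. \<Sum>k<2 ^ n.
      pauli_op (s # ss) $$ (a * 2 ^ n + i, b * 2 ^ n + j) *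
      cnj (pauli_op (p # ps) $$ (c * 2 ^ n + k, b * 2 ^ n + j)) *
      pauli_op (q # qs) $$ (c * 2 ^ n + k, a * 2 ^ n + i))"
    unfolding trace3_def sum_qubit_split ..
  also have "\<dots> = (\<Sum>a<2. \<Sum>i<2 ^ n. \<Sum>b<2. \<Sum>j<2 ^ n. \<Sum>c<2. \<Sum>k<2 ^ n.
      (pauli_mat s $$ (a, b) * cnj (pauli_mat p $$ (c, b)) * pauli_mat q $$ (c, a)) *
      (pauli_op ss $$ (i, j) * cnj (pauli_op ps $$ (k, j)) * pauli_op qs $$ (k, i)))"
    by (intro sum.cong refl)
       (simp only: idx[OF assms(1)] idx[OF assms(2)] idx[OF assms(3)] lessThan_iff complex_cnj_mult mult_ac)
  also have "\<dots> = trace3 2 (pauli_mat s) (pauli_mat p) (pauli_mat q) *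
    trace3 (2 ^ n) (pauli_op ss) (pauli_op ps) (pauli_op qs)"
    unfolding trace3_def sum_product ..
  finally show ?thesis .
qed

text \<open>Fix \<open>\<sigma> \<noteq> Pauli_I\<close> and a Pauli matrix \<open>\<rho>\<close> anticommuting with \<open>\<sigma>\<close>.  Every Pauli matrix is
  \<open>phase \<sigma> p\<close> times \<open>\<rho>\<^sup>t \<sigma>\<^sup>z\<close>, where \<open>t\<close> and \<open>z\<close> are the bits \<open>flips \<sigma> p\<close> and \<open>zbit \<sigma> p\<close>.
  Here \<open>\<rho>\<close> is \<open>Z\<close>, \<open>X\<close>, \<open>X\<close> for \<open>\<sigma> = X, Y, Z\<close>.\<close>

definition flips :: "pauli \<Rightarrow> pauli \<Rightarrow> bool" where
  "flips \<sigma> p \<longleftrightarrow> p \<noteq> Pauli_I \<and> p \<noteq> \<sigma>"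

definition zbit :: "pauli \<Rightarrow> pauli \<Rightarrow> bool" where
  "zbit \<sigma> p \<longleftrightarrow> p \<noteq> Pauli_I \<and> (p = \<sigma> \<or> p = (if \<sigma> = Pauli_Y then Pauli_Z else Pauli_Y))"

definition phase :: "pauli \<Rightarrow> pauli \<Rightarrow> complex" where
  "phase \<sigma> p = (if flips \<sigma> p \<and> zbit \<sigma> p then (if \<sigma> = Pauli_Z then \<i> else - \<i>) else 1)"

text \<open>In the adjoint of \<open>p\<close> followed by \<open>q\<close>, the two powers of
  \<rho> stand next to each other, and equal powers cancel without a sign. What remains is a power
  of \<open>\<sigma>\<close>, whose trace against \<open>s\<close> is nonzero only if
  \<open>s\<close> is the same power. If the powers of \<rho> differ, the product is traceless. The
  proof checks all cases.\<close>

lemma trace3_pauli_mat: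
  assumes "\<sigma> \<noteq> Pauli_I" "s \<in> {Pauli_I, \<sigma>}"
  shows "trace3 2 (pauli_mat s) (pauli_mat p) (pauli_mat q) =
    (if flips \<sigma> p = flips \<sigma> q \<and> s = (if zbit \<sigma> p \<noteq> zbit \<sigma> q then \<sigma> else Pauli_I)
     then 2 * cnj (phase \<sigma> p) * phase \<sigma> q else 0)"
  using assms
  by (cases \<sigma>; cases s; cases p; cases q)
     (simp_all add: trace3_def numeral_2_eq_2 flips_def zbit_def phase_def mult.assoc del: pauli_mat.simps)

definition string_phase :: "pauli \<Rightarrow> pauli list \<Rightarrow> complex" where
  "string_phase \<sigma> ps = prod_list (map (phase \<sigma>) ps)"

definition zdiff :: "pauli \<Rightarrow> pauli list \<Rightarrow> pauli list \<Rightarrow> pauli list" where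
  "zdiff \<sigma> ps qs = map2 (\<lambda>p q. if zbit \<sigma> p \<noteq> zbit \<sigma> q then \<sigma> else Pauli_I) ps qs"

lemma trace3_pauli_op:
  assumes "\<sigma> \<noteq> Pauli_I" "length ss = length ps" "length ps = length qs" "set ss \<subseteq> {Pauli_I, \<sigma>}"
  shows "trace3 (2 ^ length ss) (pauli_op ss) (pauli_op ps) (pauli_op qs) =
    (if map (flips \<sigma>) ps = map (flips \<sigma>) qs \<and> ss = zdiff \<sigma> ps qs
     then 2 ^ length ss * (cnj (string_phase \<sigma> ps) * string_phase \<sigma> qs) else 0)"
  using assms(2-4)
proof (induction ss ps qs rule: list_induct3)
  case Nil
  thus ?case by (simp add: trace3_def string_phase_def zdiff_def)
next
  case (Cons s ss p ps q qs)
  have IH: "trace3 (2 ^ length ss) (pauli_op ss) (pauli_op ps) (pauli_op qs) =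
    (if map (flips \<sigma>) ps = map (flips \<sigma>) qs \<and> ss = zdiff \<sigma> ps qs
     then 2 ^ length ss * (cnj (string_phase \<sigma> ps) * string_phase \<sigma> qs) else 0)"
    using Cons.IH Cons.prems by simp
  have s: "s \<in> {Pauli_I, \<sigma>}" using Cons.prems by simp
  have len: "length ps = length ss" "length qs = length ss" using Cons.hyps by auto
  have ph: "string_phase \<sigma> (r # rs) = phase \<sigma> r * string_phase \<sigma> rs" for r rs
    by (simp add: string_phase_def)
  have zd: "zdiff \<sigma> (p # ps) (q # qs) = (if zbit \<sigma> p \<noteq> zbit \<sigma> q then \<sigma> else Pauli_I) # zdiff \<sigma> ps qs"
    by (simp add: zdiff_def)
  have "trace3 (2 ^ length (s # ss)) (pauli_op (s # ss)) (pauli_op (p # ps)) (pauli_op (q # qs)) =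
    trace3 2 (pauli_mat s) (pauli_mat p) (pauli_mat q) *
    trace3 (2 ^ length ss) (pauli_op ss) (pauli_op ps) (pauli_op qs)"
    using trace3_pauli_Cons[OF refl len] by (simp only: list.size add_0_right add_Suc_right)
  thus ?case
    unfolding IH trace3_pauli_mat[OF assms(1) s] ph zd list.map list.inject
    by (simp add: mult_ac)
qed

lemma zdiff_nth:
  "i < length ps \<Longrightarrow> i < length qs \<Longrightarrow>
    zdiff \<sigma> ps qs ! i = (if zbit \<sigma> (ps ! i) \<noteq> zbit \<sigma> (qs ! i) then \<sigma> else Pauli_I)"
  by (simp add: zdiff_def)

text \<open>The qubits on which the \<open>\<sigma>\<close>-part of the string acts, in the
  factorisation of each Pauli matrix into a power of \<rho> and a power of
  \<open>\<sigma>\<close>.\<close>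

definition zset :: "pauli \<Rightarrow> pauli list \<Rightarrow> nat set" where
  "zset \<sigma> ps = {i. i < length ps \<and> zbit \<sigma> (ps ! i)}"

lemma zset_subset: "length ps = n \<Longrightarrow> zset \<sigma> ps \<subseteq> {..<n}"
  by (auto simp: zset_def)

text \<open>A qubit with a \<open>\<sigma>\<close>-factor is not the identity. In this way the
  degree of a test operator limits the parities that occur in its square.\<close>

lemma card_zset_le: "card (zset \<sigma> ps) \<le> pauli_weight ps"
  unfolding pauli_weight_def pauli_support_def zset_def
  by (intro card_mono) (auto simp: zbit_def)

lemma one_basis_string_eq_zdiff_iff:
  assumes "\<sigma> \<noteq> Pauli_I" "length ps = n" "length qs = n" "S \<subseteq> {..<n}"
  shows "one_basis_string n \<sigma> S = zdiff \<sigma> ps qs \<longleftrightarrow> S = sym_diff (zset \<sigma> ps) (zset \<sigma> qs)"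
proof -
  have "one_basis_string n \<sigma> S = zdiff \<sigma> ps qs \<longleftrightarrow>
      (\<forall>i<n. (i \<in> S) = (zbit \<sigma> (ps ! i) \<noteq> zbit \<sigma> (qs ! i)))"
    using assms(1-3) by (auto simp: list_eq_iff_nth_eq one_basis_string_def zdiff_nth zdiff_def)
  also have "\<dots> \<longleftrightarrow> S = sym_diff (zset \<sigma> ps) (zset \<sigma> qs)"
    using assms(2-4) by (auto simp: zset_def)
  finally show ?thesis .
qed

lemma length_one_basis_string [simp]: "length (one_basis_string n \<sigma> S) = n"
  by (simp add: one_basis_string_def)

lemma set_one_basis_string: "set (one_basis_string n \<sigma> S) \<subseteq> {Pauli_I, \<sigma>}"
  by (auto simp: one_basis_string_def)

lemma trace3_one_basis:
  assumes "\<sigma> \<noteq> Pauli_I" "ps \<in> pauli_strings n" "qs \<in> pauli_strings n" "S \<subseteq> {..<n}"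
  shows "trace3 (2 ^ n) (pauli_op (one_basis_string n \<sigma> S)) (pauli_op ps) (pauli_op qs) =
    (if map (flips \<sigma>) ps = map (flips \<sigma>) qs \<and> S = sym_diff (zset \<sigma> ps) (zset \<sigma> qs)
     then 2 ^ n * (cnj (string_phase \<sigma> ps) * string_phase \<sigma> qs) else 0)"
  using trace3_pauli_op[OF assms(1) _ _ set_one_basis_string, of n S ps qs]
    one_basis_string_eq_zdiff_iff[OF assms(1) _ _ assms(4), of ps qs] assms(2,3)
  by (simp add: pauli_strings_def)

lemma pauli_op_identity: "pauli_op (replicate n Pauli_I) = 1\<^sub>m (2 ^ n)"
proof (induction n)
  case (Suc n)
  have "kronecker (1\<^sub>m 2) (1\<^sub>m (2 ^ n)) = (1\<^sub>m (2 * 2 ^ n) :: complex mat)"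
  proof (rule eq_matI)
    fix i j :: nat
    assume "i < dim_row (1\<^sub>m (2 * 2 ^ n) :: complex mat)" "j < dim_col (1\<^sub>m (2 * 2 ^ n) :: complex mat)"
    hence ij: "i < 2 * 2 ^ n" "j < 2 * 2 ^ n" by auto
    hence "i div 2 ^ n < 2" "j div 2 ^ n < 2" by (auto simp: less_mult_imp_div_less)
    moreover have "i = j \<longleftrightarrow> i div 2 ^ n = j div 2 ^ n \<and> i mod 2 ^ n = j mod 2 ^ n"
      by (metis div_mod_decomp)
    ultimately show "kronecker (1\<^sub>m 2) (1\<^sub>m (2 ^ n)) $$ (i, j) = (1\<^sub>m (2 * 2 ^ n) :: complex mat) $$ (i, j)"
      using ij by (auto simp: kronecker_def)
  qed (auto)
  thus ?case using Suc by simp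
qed simp

text \<open>Orthogonality of the \<open>\<sigma>\<close>-strings, obtained from the threefold trace
  by inserting the identity string in the middle.\<close>

lemma trace_one_basis:
  assumes "\<sigma> \<noteq> Pauli_I" "S \<subseteq> {..<n}" "C \<subseteq> {..<n}"
  shows "(\<Sum>i<2 ^ n. \<Sum>j<2 ^ n. pauli_op (one_basis_string n \<sigma> S) $$ (i, j) *
      pauli_op (one_basis_string n \<sigma> C) $$ (j, i)) = (if S = C then 2 ^ n else 0)"
proof -
  let ?I = "replicate n Pauli_I" and ?C = "one_basis_string n \<sigma> C"
  have flips: "map (flips \<sigma>) ?I = map (flips \<sigma>) ?C"
    by (auto simp: list_eq_iff_nth_eq one_basis_string_def flips_def)
  have z: "zset \<sigma> ?I = {}" "zset \<sigma> ?C = C"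
    using assms by (auto simp: zset_def zbit_def one_basis_string_def split: if_splits)
  have "phase \<sigma> p = 1" if "p \<in> {Pauli_I, \<sigma>}" for p using that by (auto simp: phase_def flips_def)
  hence ph: "string_phase \<sigma> ps = 1" if "set ps \<subseteq> {Pauli_I, \<sigma>}" for ps
    using that unfolding string_phase_def by (induction ps) auto
  have ph_I: "string_phase \<sigma> ?I = 1" by (rule ph) auto
  have "(\<Sum>i<2 ^ n. \<Sum>j<2 ^ n. pauli_op (one_basis_string n \<sigma> S) $$ (i, j) * pauli_op ?C $$ (j, i)) =
    trace3 (2 ^ n) (pauli_op (one_basis_string n \<sigma> S)) (pauli_op ?I) (pauli_op ?C)"
    unfolding trace3_def
  proof (intro sum.cong refl)
    fix i j :: nat assume ij: "i \<in> {..<2 ^ n}" "j \<in> {..<2 ^ n}"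
    have "(\<Sum>k<2 ^ n. pauli_op (one_basis_string n \<sigma> S) $$ (i, j) * cnj (pauli_op ?I $$ (k, j)) * pauli_op ?C $$ (k, i))
      = (\<Sum>k<2 ^ n. if k = j then pauli_op (one_basis_string n \<sigma> S) $$ (i, j) * pauli_op ?C $$ (k, i) else 0)"
      using ij by (intro sum.cong refl) (auto simp: pauli_op_identity)
    thus "pauli_op (one_basis_string n \<sigma> S) $$ (i, j) * pauli_op ?C $$ (j, i) =
      (\<Sum>k<2 ^ n. pauli_op (one_basis_string n \<sigma> S) $$ (i, j) * cnj (pauli_op ?I $$ (k, j)) * pauli_op ?C $$ (k, i))"
      using ij by simp
  qed
  also have "\<dots> = (if S = C then 2 ^ n else 0)"
    by (subst trace3_one_basis)
       (use assms flips z ph[OF set_one_basis_string] ph_I in \<open>auto simp: pauli_strings_def\<close>)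
  finally show ?thesis .
qed


section \<open>The pseudo-expectation of the derived signs\<close>

text \<open>The operator in the span of the \<open>\<sigma>\<close>-strings whose trace against
  \<sigma>_S is \<open>\<tau> S\<close>. Positivity is established only against squares of low
  degree.\<close>

definition pseudo_density :: "nat \<Rightarrow> pauli \<Rightarrow> (nat set \<Rightarrow> real) \<Rightarrow> nat \<times> nat \<Rightarrow> complex" where
  "pseudo_density n \<sigma> \<tau> ij =
     (\<Sum>S\<in>Pow {..<n}. of_real (\<tau> S) / 2 ^ n * pauli_op (one_basis_string n \<sigma> S) $$ ij)"

text \<open>The trace of the pseudo-density times \<open>A\<close>. As a trace it is linear on all
  matrices of the right size, whatever their degree.\<close>

definition sign_expectation :: "nat \<Rightarrow> pauli \<Rightarrow> (nat set \<Rightarrow> real) \<Rightarrow> complex mat \<Rightarrow> complex" where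
  "sign_expectation n \<sigma> \<tau> A = (\<Sum>i<2 ^ n. \<Sum>j<2 ^ n. pseudo_density n \<sigma> \<tau> (i, j) * A $$ (j, i))"

lemma sign_expectation_add:
  assumes "A \<in> carrier_mat (2 ^ n) (2 ^ n)" "B \<in> carrier_mat (2 ^ n) (2 ^ n)"
  shows "sign_expectation n \<sigma> \<tau> (A + B) = sign_expectation n \<sigma> \<tau> A + sign_expectation n \<sigma> \<tau> B"
  using assms by (simp add: sign_expectation_def distrib_left sum.distrib)

lemma sign_expectation_smult:
  assumes "A \<in> carrier_mat (2 ^ n) (2 ^ n)"
  shows "sign_expectation n \<sigma> \<tau> (a \<cdot>\<^sub>m A) = a * sign_expectation n \<sigma> \<tau> A"
  using assms by (simp add: sign_expectation_def sum_distrib_left mult.left_commute)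

lemma sign_expectation_mat:
  "sign_expectation n \<sigma> \<tau> A = (\<Sum>S\<in>Pow {..<n}. of_real (\<tau> S) / 2 ^ n *
     (\<Sum>i<2 ^ n. \<Sum>j<2 ^ n. pauli_op (one_basis_string n \<sigma> S) $$ (i, j) * A $$ (j, i)))"
proof -
  have "sign_expectation n \<sigma> \<tau> A = (\<Sum>i<2 ^ n. \<Sum>j<2 ^ n. \<Sum>S\<in>Pow {..<n}. of_real (\<tau> S) / 2 ^ n *
     (pauli_op (one_basis_string n \<sigma> S) $$ (i, j) * A $$ (j, i)))"
    by (simp add: sign_expectation_def pseudo_density_def sum_distrib_right mult.assoc)
  also have "\<dots> = (\<Sum>i<2 ^ n. \<Sum>S\<in>Pow {..<n}. \<Sum>j<2 ^ n. of_real (\<tau> S) / 2 ^ n *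
     (pauli_op (one_basis_string n \<sigma> S) $$ (i, j) * A $$ (j, i)))"
    by (intro sum.cong refl sum.swap)
  also have "\<dots> = (\<Sum>S\<in>Pow {..<n}. \<Sum>i<2 ^ n. \<Sum>j<2 ^ n. of_real (\<tau> S) / 2 ^ n *
     (pauli_op (one_basis_string n \<sigma> S) $$ (i, j) * A $$ (j, i)))"
    by (rule sum.swap)
  finally show ?thesis by (simp only: sum_distrib_left)
qed

lemma sign_expectation_one_basis:
  assumes "\<sigma> \<noteq> Pauli_I" "C \<subseteq> {..<n}"
  shows "sign_expectation n \<sigma> \<tau> (pauli_op (one_basis_string n \<sigma> C)) = of_real (\<tau> C)"
proof -
  have "sign_expectation n \<sigma> \<tau> (pauli_op (one_basis_string n \<sigma> C)) =
      (\<Sum>S\<in>Pow {..<n}. of_real (\<tau> S) / 2 ^ n * (if S = C then 2 ^ n else 0))"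
    unfolding sign_expectation_mat
    by (intro sum.cong refl arg_cong2[where f = "(*)"] trace_one_basis) (use assms in auto)
  also have "\<dots> = (\<Sum>S\<in>Pow {..<n}. if S = C then of_real (\<tau> S) else 0)"
    by (intro sum.cong refl) simp
  also have "\<dots> = of_real (\<tau> C)" using assms by simp
  finally show ?thesis .
qed

lemma one_basis_string_empty: "pauli_op (one_basis_string n \<sigma> {}) = 1\<^sub>m (2 ^ n)"
proof -
  have "one_basis_string n \<sigma> {} = replicate n Pauli_I"
    by (simp add: one_basis_string_def map_replicate_const)
  thus ?thesis by (simp add: pauli_op_identity)
qed

lemma sign_expectation_one:
  assumes "\<sigma> \<noteq> Pauli_I"
  shows "sign_expectation n \<sigma> \<tau> (1\<^sub>m (2 ^ n)) = of_real (\<tau> {})"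
  using sign_expectation_one_basis[OF assms, of "{}"] by (simp add: one_basis_string_empty)

lemma sign_expectation_hamiltonian:
  assumes "\<sigma> \<noteq> Pauli_I" "hyperedges I \<subseteq> uniform_edges n k"
    and "pauli_at I = one_basis_string n \<sigma>"
  shows "sign_expectation n \<sigma> \<tau> (kxor_hamiltonian n I) =
    (\<Sum>C\<in>hyperedges I. of_real (\<tau> {}) + of_real (sign_at I C * \<tau> C)) / (2 * of_nat (card (hyperedges I)))"
proof -
  let ?m = "of_nat (card (hyperedges I)) :: complex"
  let ?W = "pseudo_density n \<sigma> \<tau>" and ?P = "\<lambda>C. pauli_op (one_basis_string n \<sigma> C)"
  have "sign_expectation n \<sigma> \<tau> (kxor_hamiltonian n I) = (\<Sum>i<2 ^ n. \<Sum>j<2 ^ n. \<Sum>C\<in>hyperedges I.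
      (?W (i, j) * 1\<^sub>m (2 ^ n) $$ (j, i) + of_real (sign_at I C) * (?W (i, j) * ?P C $$ (j, i))) / (2 * ?m))"
    unfolding sign_expectation_def kxor_hamiltonian_def assms(3)
    by (intro sum.cong refl) (simp add: sum_distrib_left sum_divide_distrib field_simps)
  also have "\<dots> = (\<Sum>i<2 ^ n. \<Sum>C\<in>hyperedges I. \<Sum>j<2 ^ n.
      (?W (i, j) * 1\<^sub>m (2 ^ n) $$ (j, i) + of_real (sign_at I C) * (?W (i, j) * ?P C $$ (j, i))) / (2 * ?m))"
    by (intro sum.cong refl sum.swap)
  also have "\<dots> = (\<Sum>C\<in>hyperedges I. \<Sum>i<2 ^ n. \<Sum>j<2 ^ n.
      (?W (i, j) * 1\<^sub>m (2 ^ n) $$ (j, i) + of_real (sign_at I C) * (?W (i, j) * ?P C $$ (j, i))) / (2 * ?m))"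
    by (rule sum.swap)
  also have "\<dots> = (\<Sum>C\<in>hyperedges I. (sign_expectation n \<sigma> \<tau> (1\<^sub>m (2 ^ n)) +
      of_real (sign_at I C) * sign_expectation n \<sigma> \<tau> (?P C)) / (2 * ?m))"
    unfolding sign_expectation_def
    by (simp only: sum.distrib sum_distrib_left sum_divide_distrib add_divide_distrib)
  also have "\<dots> = (\<Sum>C\<in>hyperedges I. (of_real (\<tau> {}) + of_real (sign_at I C * \<tau> C)) / (2 * ?m))"
    using assms(2) sign_expectation_one[OF assms(1)] sign_expectation_one_basis[OF assms(1)]
    by (intro sum.cong refl) (auto simp: uniform_edges_def lessThan_atLeast0)
  finally show ?thesis by (simp only: sum_divide_distrib)
qed

section \<open>Positivity on squares of low degree\<close>

lemma finite_pauli_strings: "finite (pauli_strings n)"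
proof -
  have "(UNIV :: pauli set) = {Pauli_I, Pauli_X, Pauli_Y, Pauli_Z}"
    using pauli.exhaust by auto
  hence "finite (UNIV :: pauli set)" by (metis finite.emptyI finite.insertI)
  thus ?thesis
    using finite_lists_length_eq[of UNIV n] by (simp add: pauli_strings_def)
qed

lemma has_degree_le_carrier: "has_degree_le n d A \<Longrightarrow> A \<in> carrier_mat (2 ^ n) (2 ^ n)"
  by (auto simp: has_degree_le_def pauli_expansion_def)

lemma mat_adjoint_mult_index:
  fixes B :: "complex mat"
  assumes "B \<in> carrier_mat N N" "i < N" "j < N"
  shows "(mat_adjoint B * B) $$ (j, i) = (\<Sum>k<N. cnj (B $$ (k, j)) * B $$ (k, i))"
  using assms
  by (auto simp: mat_adjoint_def scalar_prod_def lessThan_atLeast0 mat_of_rows_def conjugate_vec_def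
      intro!: sum.cong)

lemma sum_swap3:
  "(\<Sum>i\<in>A. \<Sum>j\<in>B. \<Sum>k\<in>C. \<Sum>y\<in>Y. g i j k y) = (\<Sum>y\<in>Y. \<Sum>i\<in>A. \<Sum>j\<in>B. \<Sum>k\<in>C. g i j k y)"
proof -
  have "(\<Sum>i\<in>A. \<Sum>j\<in>B. \<Sum>k\<in>C. \<Sum>y\<in>Y. g i j k y) = (\<Sum>i\<in>A. \<Sum>j\<in>B. \<Sum>y\<in>Y. \<Sum>k\<in>C. g i j k y)"
    by (rule sum.cong[OF refl sum.cong[OF refl sum.swap]])
  also have "\<dots> = (\<Sum>i\<in>A. \<Sum>y\<in>Y. \<Sum>j\<in>B. \<Sum>k\<in>C. g i j k y)"
    by (rule sum.cong[OF refl sum.swap])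
  also have "\<dots> = (\<Sum>y\<in>Y. \<Sum>i\<in>A. \<Sum>j\<in>B. \<Sum>k\<in>C. g i j k y)"
    by (rule sum.swap)
  finally show ?thesis .
qed

text \<open>Expanding both copies of the operator gives threefold traces indexed by
  \<open>S\<close>, \<open>p\<close> and \<open>q\<close>. Orthogonality leaves a single
  \<open>S\<close> for each pair, and the phases move into the coefficients, so that the remaining
  kernel is real.\<close>

lemma sign_expectation_square:
  assumes "\<sigma> \<noteq> Pauli_I"
  shows "sign_expectation n \<sigma> \<tau> (mat_adjoint (pauli_expansion n c) * pauli_expansion n c) =
    (\<Sum>p\<in>pauli_strings n. \<Sum>q\<in>pauli_strings n.
      cnj (c p * string_phase \<sigma> p) * (c q * string_phase \<sigma> q) *
      of_real (if map (flips \<sigma>) p = map (flips \<sigma>) q then \<tau> (sym_diff (zset \<sigma> p) (zset \<sigma> q)) else 0))"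
proof -
  let ?X = "pauli_strings n" and ?B = "pauli_expansion n c"
  let ?P = "\<lambda>C. pauli_op (one_basis_string n \<sigma> C)"
  have B: "?B \<in> carrier_mat (2 ^ n) (2 ^ n)" by (simp add: pauli_expansion_def)
  have trace: "(\<Sum>i<2 ^ n. \<Sum>j<2 ^ n. ?P S $$ (i, j) * (mat_adjoint ?B * ?B) $$ (j, i)) =
      (\<Sum>p\<in>?X. \<Sum>q\<in>?X. cnj (c p) * c q * trace3 (2 ^ n) (?P S) (pauli_op p) (pauli_op q))" for S
  proof -
    let ?G = "\<lambda>i j k p q. cnj (c p) * c q * (?P S $$ (i, j) * cnj (pauli_op p $$ (k, j)) * pauli_op q $$ (k, i))"
    have "(\<Sum>i<2 ^ n. \<Sum>j<2 ^ n. ?P S $$ (i, j) * (mat_adjoint ?B * ?B) $$ (j, i)) =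
      (\<Sum>i<2 ^ n. \<Sum>j<2 ^ n. \<Sum>k<2 ^ n. \<Sum>p\<in>?X. \<Sum>q\<in>?X. ?G i j k p q)"
    proof (intro sum.cong refl)
      fix i j :: nat assume ij: "i \<in> {..<2 ^ n}" "j \<in> {..<2 ^ n}"
      have "?P S $$ (i, j) * (mat_adjoint ?B * ?B) $$ (j, i) =
          (\<Sum>k<2 ^ n. ?P S $$ (i, j) * (cnj (?B $$ (k, j)) * ?B $$ (k, i)))"
        using ij by (simp add: mat_adjoint_mult_index[OF B] sum_distrib_left)
      also have "\<dots> = (\<Sum>k<2 ^ n. \<Sum>p\<in>?X. \<Sum>q\<in>?X. ?G i j k p q)"
      proof (intro sum.cong refl)
        fix k :: nat assume k: "k \<in> {..<2 ^ n}"
        have "cnj (?B $$ (k, j)) * ?B $$ (k, i) =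
          (\<Sum>p\<in>?X. cnj (c p * pauli_op p $$ (k, j))) * (\<Sum>q\<in>?X. c q * pauli_op q $$ (k, i))"
          using ij k by (simp add: pauli_expansion_def)
        also have "\<dots> = (\<Sum>p\<in>?X. \<Sum>q\<in>?X. cnj (c p * pauli_op p $$ (k, j)) * (c q * pauli_op q $$ (k, i)))"
          by (rule sum_product)
        finally show "?P S $$ (i, j) * (cnj (?B $$ (k, j)) * ?B $$ (k, i)) = (\<Sum>p\<in>?X. \<Sum>q\<in>?X. ?G i j k p q)"
          by (simp only: sum_distrib_left complex_cnj_mult mult_ac)
      qed
      finally show "?P S $$ (i, j) * (mat_adjoint ?B * ?B) $$ (j, i) =
          (\<Sum>k<2 ^ n. \<Sum>p\<in>?X. \<Sum>q\<in>?X. ?G i j k p q)" .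
    qed
    also have "\<dots> = (\<Sum>p\<in>?X. \<Sum>i<2 ^ n. \<Sum>j<2 ^ n. \<Sum>k<2 ^ n. \<Sum>q\<in>?X. ?G i j k p q)"
      by (rule sum_swap3)
    also have "\<dots> = (\<Sum>p\<in>?X. \<Sum>q\<in>?X. \<Sum>i<2 ^ n. \<Sum>j<2 ^ n. \<Sum>k<2 ^ n. ?G i j k p q)"
      by (rule sum.cong[OF refl sum_swap3])
    finally show ?thesis by (simp only: trace3_def sum_distrib_left)
  qed
  let ?K = "\<lambda>p q. if map (flips \<sigma>) p = map (flips \<sigma>) q then \<tau> (sym_diff (zset \<sigma> p) (zset \<sigma> q)) else 0"
  \<comment> \<open>Only \<open>S = ?D\<close> survives, and the trace factor \<open>2 ^ n\<close>
    cancels the normalisation of the pseudo-density.\<close>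
  have inner: "(\<Sum>S\<in>Pow {..<n}. of_real (\<tau> S) / 2 ^ n * trace3 (2 ^ n) (?P S) (pauli_op p) (pauli_op q)) =
      cnj (string_phase \<sigma> p) * string_phase \<sigma> q * of_real (?K p q)"
    if p: "p \<in> ?X" and q: "q \<in> ?X" for p q
  proof -
    let ?D = "sym_diff (zset \<sigma> p) (zset \<sigma> q)"
    have D: "?D \<subseteq> {..<n}" using p q zset_subset[of _ n] by (auto simp: pauli_strings_def)
    have "(\<Sum>S\<in>Pow {..<n}. of_real (\<tau> S) / 2 ^ n * trace3 (2 ^ n) (?P S) (pauli_op p) (pauli_op q)) =
      (\<Sum>S\<in>Pow {..<n}. if S = ?D then cnj (string_phase \<sigma> p) * string_phase \<sigma> q * of_real (?K p q) else 0)"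
      using trace3_one_basis[OF assms p q]
      by (intro sum.cong refl) (simp add: field_simps)
    thus ?thesis using D by simp
  qed
  have "sign_expectation n \<sigma> \<tau> (mat_adjoint ?B * ?B) =
      (\<Sum>S\<in>Pow {..<n}. \<Sum>p\<in>?X. \<Sum>q\<in>?X. cnj (c p) * c q *
        (of_real (\<tau> S) / 2 ^ n * trace3 (2 ^ n) (?P S) (pauli_op p) (pauli_op q)))"
    unfolding sign_expectation_mat trace sum_distrib_left by (simp only: mult_ac)
  also have "\<dots> = (\<Sum>p\<in>?X. \<Sum>S\<in>Pow {..<n}. \<Sum>q\<in>?X. cnj (c p) * c q *
        (of_real (\<tau> S) / 2 ^ n * trace3 (2 ^ n) (?P S) (pauli_op p) (pauli_op q)))"
    by (rule sum.swap)
  also have "\<dots> = (\<Sum>p\<in>?X. \<Sum>q\<in>?X. \<Sum>S\<in>Pow {..<n}. cnj (c p) * c q *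
        (of_real (\<tau> S) / 2 ^ n * trace3 (2 ^ n) (?P S) (pauli_op p) (pauli_op q)))"
    by (intro sum.cong refl sum.swap)
  also have "\<dots> = (\<Sum>p\<in>?X. \<Sum>q\<in>?X. cnj (c p * string_phase \<sigma> p) * (c q * string_phase \<sigma> q) * of_real (?K p q))"
    unfolding sum_distrib_left[symmetric]
    by (intro sum.cong refl) (simp only: inner complex_cnj_mult mult_ac)
  finally show ?thesis .
qed

text \<open>Linearity and normalisation are immediate. For positivity, the multiplicativity of the
  derived signs is exactly the block condition of \<open>block_kernel_psd\<close>, applied to the
  kernel of \<open>sign_expectation_square\<close>.\<close>

lemma pseudo_expectation_sign_expectation:
  assumes \<sigma>: "\<sigma> \<noteq> Pauli_I" and E: "expanding E r D" and b: "\<And>C. C \<in> E \<Longrightarrow> b C \<in> {1, - 1}"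
  shows "pseudo_expectation n D (sign_expectation n \<sigma> (derived_sign E b r))"
  unfolding pseudo_expectation_def
proof (intro conjI allI impI)
  fix d B assume d: "2 * d \<le> D" and B: "has_degree_le n d B"
  define \<tau> where "\<tau> = derived_sign E b r"
  obtain c where c: "B = pauli_expansion n c" "\<And>p. p \<in> pauli_strings n \<Longrightarrow> c p \<noteq> 0 \<Longrightarrow> pauli_weight p \<le> d"
    using B by (auto simp: has_degree_le_def)
  let ?S = "pauli_strings n" and ?X = "{p\<in>pauli_strings n. c p \<noteq> 0}"
  let ?c = "\<lambda>p. c p * string_phase \<sigma> p"
  let ?K = "\<lambda>p q. if map (flips \<sigma>) p = map (flips \<sigma>) q then \<tau> (sym_diff (zset \<sigma> p) (zset \<sigma> q)) else 0"
  have X: "?X \<subseteq> ?S" "finite ?S" using finite_pauli_strings by auto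
  have z: "card (zset \<sigma> p) \<le> d" "finite (zset \<sigma> p)" if "p \<in> ?X" for p
    using c(2)[of p] that card_zset_le[of \<sigma> p] by (auto simp: zset_def)
  have "sign_expectation n \<sigma> \<tau> (mat_adjoint B * B) =
      (\<Sum>p\<in>?S. \<Sum>q\<in>?S. cnj (?c p) * ?c q * of_real (?K p q))"
    unfolding c(1) by (rule sign_expectation_square[OF \<sigma>])
  \<comment> \<open>The sums are restricted to strings with nonzero coefficient, since the weight
    bound is available only for these.\<close>
  also have "\<dots> = (\<Sum>p\<in>?X. \<Sum>q\<in>?S. cnj (?c p) * ?c q * of_real (?K p q))"
    using X by (intro sum.mono_neutral_right) auto
  also have "\<dots> = (\<Sum>p\<in>?X. \<Sum>q\<in>?X. cnj (?c p) * ?c q * of_real (?K p q))"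
    using X by (intro sum.cong refl sum.mono_neutral_right) auto
  also have "0 \<le> \<dots>"
  proof (rule block_kernel_psd)
    show "finite ?X" using X finite_subset by blast
    show "?K p p = 1" for p using derived_sign_empty[OF E b] by (simp add: \<tau>_def)
    show "?K p q = ?K q p" for p q by (simp add: Un_commute eq_commute)
    fix p q s assume pqs: "p \<in> ?X" "q \<in> ?X" "s \<in> ?X" and pq: "?K p q \<noteq> 0" and qs: "?K q s \<noteq> 0"
    let ?A = "sym_diff (zset \<sigma> p) (zset \<sigma> q)" and ?B = "sym_diff (zset \<sigma> q) (zset \<sigma> s)"
    have eq: "sym_diff (zset \<sigma> p) (zset \<sigma> s) = sym_diff ?A ?B" by auto
    have flips: "map (flips \<sigma>) p = map (flips \<sigma>) q" "map (flips \<sigma>) q = map (flips \<sigma>) s"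
      using pq qs by (auto split: if_splits)
    \<comment> \<open>The bound passes directly from \<open>p\<close> to \<open>s\<close>: the
      contribution of \<open>q\<close> has cancelled, so two sets of size at most \<open>d\<close>
      suffice.\<close>
    have "card (sym_diff (zset \<sigma> p) (zset \<sigma> s)) \<le> card (zset \<sigma> p) + card (zset \<sigma> s)"
      using z pqs by (intro card_sym_diff_le) auto
    also have "\<dots> \<le> D" using z(1)[OF pqs(1)] z(1)[OF pqs(3)] d by linarith
    finally have "card (sym_diff ?A ?B) \<le> D" unfolding eq .
    moreover have "\<tau> ?A \<noteq> 0" "\<tau> ?B \<noteq> 0" using pq qs flips by auto
    ultimately have "\<tau> (sym_diff ?A ?B) = \<tau> ?A * \<tau> ?B"
      unfolding \<tau>_def by (intro derived_sign_sym_diff[OF E b])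
    thus "?K p s = ?K p q * ?K q s" unfolding eq using flips by simp
  qed
  finally show "0 \<le> sign_expectation n \<sigma> (derived_sign E b r) (mat_adjoint B * B)"
    unfolding \<tau>_def .
next
  show "sign_expectation n \<sigma> (derived_sign E b r) (1\<^sub>m (2 ^ n)) = 1"
    using derived_sign_empty[OF E b] by (simp add: sign_expectation_one[OF \<sigma>])
qed (auto intro: sign_expectation_add sign_expectation_smult dest: has_degree_le_carrier)

text \<open>The derived sign of a hyperedge is its own sign, so every constraint is satisfied
  exactly and each term of the Hamiltonian contributes \<open>(1 + 1) / 2\<close>.\<close>

lemma exists_pseudo_expectation:
  assumes \<sigma>: "\<sigma> \<noteq> Pauli_I" and E: "expanding (hyperedges I) r D"
    and I: "hyperedges I \<subseteq> uniform_edges n k" "hyperedges I \<noteq> {}" "pauli_at I = one_basis_string n \<sigma>"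
    and b: "\<And>C. C \<in> hyperedges I \<Longrightarrow> sign_at I C \<in> {1, - 1}"
  obtains Et where "pseudo_expectation n D Et" "Et (kxor_hamiltonian n I) = 1"
proof
  let ?\<tau> = "derived_sign (hyperedges I) (sign_at I) r"
  show "pseudo_expectation n D (sign_expectation n \<sigma> ?\<tau>)"
    by (rule pseudo_expectation_sign_expectation[OF \<sigma> E b])
  have "finite (hyperedges I)" using E by (simp add: expanding_def)
  hence m: "card (hyperedges I) \<noteq> 0" using I by simp
  have "sign_at I C * ?\<tau> C = 1" if "C \<in> hyperedges I" for C
    using derived_sign_edge[OF E b that] b[OF that] by auto
  hence "(\<Sum>C\<in>hyperedges I. complex_of_real (?\<tau> {}) + of_real (sign_at I C * ?\<tau> C)) =
      (\<Sum>C\<in>hyperedges I. 2)"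
    using derived_sign_empty[OF E b] by (intro sum.cong refl) simp
  thus "sign_expectation n \<sigma> ?\<tau> (kxor_hamiltonian n I) = 1"
    using m by (simp add: sign_expectation_hamiltonian[OF \<sigma> I(1,3)])
qed

section \<open>Diagonalisation of one-basis Hamiltonians\<close>

text \<open>The mixed-product rule: the summation index splits as \<open>x * d + y\<close>, and the
  resulting double sum factors.\<close>

lemma kronecker_mult:
  assumes "A \<in> carrier_mat a b" "B \<in> carrier_mat c d" "C \<in> carrier_mat b e" "D \<in> carrier_mat d f"
  shows "kronecker A B * kronecker C D = kronecker (A * C) (B * D)"
proof (rule eq_matI)
  fix i j assume "i < dim_row (kronecker (A * C) (B * D))" "j < dim_col (kronecker (A * C) (B * D))"
  hence ij: "i < a * c" "j < e * f" using assms by auto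
  have "0 < c" using ij by (cases c) auto
  have "0 < f" using ij by (cases f) auto
  have div: "i div c < a" "i mod c < c" "j div f < e" "j mod f < f"
    using ij \<open>0 < c\<close> \<open>0 < f\<close> by (simp_all add: less_mult_imp_div_less)
  have "(kronecker A B * kronecker C D) $$ (i, j) =
      (\<Sum>k<b * d. kronecker A B $$ (i, k) * kronecker C D $$ (k, j))"
    using assms ij by (simp add: scalar_prod_def lessThan_atLeast0)
  also have "\<dots> = (\<Sum>x<b. \<Sum>y<d. (A $$ (i div c, x) * C $$ (x, j div f)) * (B $$ (i mod c, y) * D $$ (y, j mod f)))"
    unfolding sum_mult_split
  proof (intro sum.cong refl)
    fix x y assume xy: "x \<in> {..<b}" "y \<in> {..<d}"
    hence dm: "(x * d + y) div d = x" "(x * d + y) mod d = y" by auto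
    have "x * d + y < b * d" using xy by (intro mult_add_less) auto
    thus "kronecker A B $$ (i, x * d + y) * kronecker C D $$ (x * d + y, j) =
        A $$ (i div c, x) * C $$ (x, j div f) * (B $$ (i mod c, y) * D $$ (y, j mod f))"
      using assms ij xy by (simp add: kronecker_def dm)
  qed
  also have "\<dots> = (\<Sum>x<b. A $$ (i div c, x) * C $$ (x, j div f)) * (\<Sum>y<d. B $$ (i mod c, y) * D $$ (y, j mod f))"
    by (simp only: sum_product)
  also have "\<dots> = kronecker (A * C) (B * D) $$ (i, j)"
    using assms ij div by (simp add: kronecker_def scalar_prod_def lessThan_atLeast0)
  finally show "(kronecker A B * kronecker C D) $$ (i, j) = kronecker (A * C) (B * D) $$ (i, j)" .
qed (use assms in auto)

fun kron_power :: "complex mat \<Rightarrow> nat \<Rightarrow> complex mat" where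
  "kron_power A 0 = 1\<^sub>m 1"
| "kron_power A (Suc n) = kronecker A (kron_power A n)"

lemma kronecker_carrier:
  assumes "A \<in> carrier_mat a b" "B \<in> carrier_mat c d"
  shows "kronecker A B \<in> carrier_mat (a * c) (b * d)"
  by (rule carrier_matI) (use assms in simp_all)

lemma kron_power_carrier:
  assumes "A \<in> carrier_mat 2 2"
  shows "kron_power A n \<in> carrier_mat (2 ^ n) (2 ^ n)"
proof (induction n)
  case (Suc n)
  show ?case using kronecker_carrier[OF assms Suc] by simp
qed simp

lemma pauli_mat_carrier: "pauli_mat p \<in> carrier_mat 2 2"
  by (rule carrier_matI) simp_all

lemma pauli_op_carrier: "length ps = n \<Longrightarrow> pauli_op ps \<in> carrier_mat (2 ^ n) (2 ^ n)"
  by (rule carrier_matI) simp_all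

lemma kron_power_inverse:
  assumes "A \<in> carrier_mat 2 2" "B \<in> carrier_mat 2 2" "A * B = 1\<^sub>m 2"
  shows "kron_power A n * kron_power B n = 1\<^sub>m (2 ^ n)"
proof (induction n)
  case (Suc n)
  have "kron_power A (Suc n) * kron_power B (Suc n) =
      kronecker (A * B) (kron_power A n * kron_power B n)"
    unfolding kron_power.simps
    by (rule kronecker_mult[OF assms(1) kron_power_carrier[OF assms(1)] assms(2) kron_power_carrier[OF assms(2)]])
  \<comment> \<open>Both factors are read as identity Pauli strings, so that
    \<open>pauli_op_identity\<close> gives their Kronecker product.\<close>
  also have "\<dots> = kronecker (pauli_mat Pauli_I) (pauli_op (replicate n Pauli_I))"
    unfolding Suc assms(3) pauli_op_identity by simp
  also have "\<dots> = pauli_op (replicate (Suc n) Pauli_I)" by (simp only: replicate_Suc pauli_op.simps)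
  also have "\<dots> = 1\<^sub>m (2 ^ Suc n)" by (rule pauli_op_identity)
  finally show ?case .
qed simp

text \<open>The columns are eigenvectors of \<open>\<sigma>\<close> for the eigenvalues \<open>1\<close> and \<open>- 1\<close>.\<close>

fun eigenbasis :: "pauli \<Rightarrow> complex mat" where
  "eigenbasis Pauli_X = mat_of_rows_list 2 [[1, 1], [1, - 1]]"
| "eigenbasis Pauli_Y = mat_of_rows_list 2 [[1, 1], [\<i>, - \<i>]]"
| "eigenbasis _ = 1\<^sub>m 2"

text \<open>The columns of \<open>eigenbasis\<close> are not normalised for \<open>X\<close> and
  \<open>Y\<close>, so the inverse carries a factor 1/2. The argument uses similarity of matrices
  rather than unitary equivalence.\<close>

fun eigenbasis_inv :: "pauli \<Rightarrow> complex mat" where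
  "eigenbasis_inv Pauli_X = mat_of_rows_list 2 [[1 / 2, 1 / 2], [1 / 2, - 1 / 2]]"
| "eigenbasis_inv Pauli_Y = mat_of_rows_list 2 [[1 / 2, - \<i> / 2], [1 / 2, \<i> / 2]]"
| "eigenbasis_inv _ = 1\<^sub>m 2"

lemma eigenbasis_carrier: "eigenbasis \<sigma> \<in> carrier_mat 2 2" "eigenbasis_inv \<sigma> \<in> carrier_mat 2 2"
  by (rule carrier_matI; induction \<sigma>; simp add: mat_of_rows_list_def)
     (rule carrier_matI; induction \<sigma>; simp add: mat_of_rows_list_def)

lemma mat_2_eqI:
  assumes "dim_row A = 2" "dim_col A = 2" "dim_row B = 2" "dim_col B = 2"
    and "A $$ (0, 0) = B $$ (0, 0)" "A $$ (0, Suc 0) = B $$ (0, Suc 0)"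
      "A $$ (Suc 0, 0) = B $$ (Suc 0, 0)" "A $$ (Suc 0, Suc 0) = B $$ (Suc 0, Suc 0)"
  shows "A = B"
  using assms by (intro eq_matI) (auto simp: less_2_cases_iff)

lemma eigenbasis_inverse:
  "eigenbasis \<sigma> * eigenbasis_inv \<sigma> = 1\<^sub>m 2" "eigenbasis_inv \<sigma> * eigenbasis \<sigma> = 1\<^sub>m 2"
  by (cases \<sigma>; intro mat_2_eqI;
      simp add: mat_of_rows_list_def scalar_prod_def numeral_2_eq_2 field_simps)+

lemma pauli_mult_eigenbasis:
  assumes "p \<in> {Pauli_I, \<sigma>}"
  shows "pauli_mat p * eigenbasis \<sigma> =
    eigenbasis \<sigma> * pauli_mat (if p = Pauli_I then Pauli_I else Pauli_Z)"
  using assms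
  by (cases p; cases \<sigma>; simp; intro mat_2_eqI;
      simp add: mat_of_rows_list_def scalar_prod_def numeral_2_eq_2)

text \<open>The one-qubit change of basis turns \<open>\<sigma>\<close> into \<open>Z\<close>; the
  mixed-product rule extends this to strings by induction.\<close>

lemma pauli_op_mult_kron_power:
  assumes "set ps \<subseteq> {Pauli_I, \<sigma>}"
  shows "pauli_op ps * kron_power (eigenbasis \<sigma>) (length ps) =
    kron_power (eigenbasis \<sigma>) (length ps) *
    pauli_op (map (\<lambda>p. if p = Pauli_I then Pauli_I else Pauli_Z) ps)"
  using assms
proof (induction ps)
  case (Cons p ps)
  let ?f = "\<lambda>p. if p = Pauli_I then Pauli_I else Pauli_Z"
  let ?U = "eigenbasis \<sigma>" and ?V = "kron_power (eigenbasis \<sigma>) (length ps)"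
  have V: "?V \<in> carrier_mat (2 ^ length ps) (2 ^ length ps)"
    by (rule kron_power_carrier[OF eigenbasis_carrier(1)])
  have "kronecker (pauli_mat p) (pauli_op ps) * kronecker ?U ?V =
      kronecker (pauli_mat p * ?U) (pauli_op ps * ?V)"
    by (rule kronecker_mult[OF pauli_mat_carrier pauli_op_carrier[OF refl] eigenbasis_carrier(1) V])
  also have "\<dots> = kronecker (?U * pauli_mat (?f p)) (?V * pauli_op (map ?f ps))"
    using Cons pauli_mult_eigenbasis[of p \<sigma>] by auto
  also have "\<dots> = kronecker ?U ?V * kronecker (pauli_mat (?f p)) (pauli_op (map ?f ps))"
    by (rule kronecker_mult[OF eigenbasis_carrier(1) V pauli_mat_carrier pauli_op_carrier, symmetric]) simp
  finally show ?case by simp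
qed simp

lemma one_basis_mult_eigenbasis:
  assumes "\<sigma> \<noteq> Pauli_I"
  shows "pauli_op (one_basis_string n \<sigma> C) * kron_power (eigenbasis \<sigma>) n =
    kron_power (eigenbasis \<sigma>) n * pauli_op (one_basis_string n Pauli_Z C)"
proof -
  have "map (\<lambda>p. if p = Pauli_I then Pauli_I else Pauli_Z) (one_basis_string n \<sigma> C) =
      one_basis_string n Pauli_Z C"
    using assms by (simp add: one_basis_string_def)
  thus ?thesis
    using pauli_op_mult_kron_power[OF set_one_basis_string, of n \<sigma> C] by simp
qed

section \<open>Spectrum of the diagonal Hamiltonian\<close>

lemma pauli_op_Z_entries:
  assumes "set ps \<subseteq> {Pauli_I, Pauli_Z}" "i < 2 ^ length ps" "j < 2 ^ length ps"
  shows "pauli_op ps $$ (i, j) \<in> (if i = j then {1, - 1} else {0})"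
  using assms
proof (induction ps arbitrary: i j)
  case (Cons p ps)
  let ?N = "2 ^ length ps :: nat"
  have dm: "i div ?N < 2" "j div ?N < 2" "i mod ?N < ?N" "j mod ?N < ?N"
    using Cons.prems by (auto simp: less_mult_imp_div_less)
  have "pauli_op (p # ps) $$ (i, j) = pauli_op (p # ps) $$ (i div ?N * ?N + i mod ?N, j div ?N * ?N + j mod ?N)"
    by (simp only: div_mult_mod_eq)
  also have "\<dots> = pauli_mat p $$ (i div ?N, j div ?N) * pauli_op ps $$ (i mod ?N, j mod ?N)"
    by (rule pauli_op_Cons_index[OF dm])
  finally have eq: "pauli_op (p # ps) $$ (i, j) =
      pauli_mat p $$ (i div ?N, j div ?N) * pauli_op ps $$ (i mod ?N, j mod ?N)" .
  have IH: "pauli_op ps $$ (i mod ?N, j mod ?N) \<in> (if i mod ?N = j mod ?N then {1, - 1} else {0})"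
    using Cons dm by auto
  have p: "pauli_mat p $$ (x, y) \<in> (if x = y then {1, - 1} else {0})" if "x < 2" "y < 2" for x y
    using that Cons.prems(1) by (auto simp: less_2_cases_iff simp del: pauli_mat.simps)
  have "i = j \<longleftrightarrow> i div ?N = j div ?N \<and> i mod ?N = j mod ?N" by (metis div_mod_decomp)
  thus ?case using IH p[OF dm(1,2)] unfolding eq by (auto split: if_splits)
qed simp

text \<open>The value of the classical parity on \<open>C\<close> at the basis vector
  \<open>i\<close>, read off the diagonal of the corresponding \<open>Z\<close>-string.\<close>

definition z_sign :: "nat \<Rightarrow> nat \<Rightarrow> nat set \<Rightarrow> real" where
  "z_sign n i C = Re (pauli_op (one_basis_string n Pauli_Z C) $$ (i, i))"

lemma pauli_op_one_basis_Z:
  assumes "i < 2 ^ n" "j < 2 ^ n"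
  shows "pauli_op (one_basis_string n Pauli_Z C) $$ (i, j) = (if i = j then of_real (z_sign n i C) else 0)"
  using pauli_op_Z_entries[OF set_one_basis_string, of i n C j] assms
  by (auto simp: z_sign_def split: if_splits)

lemma z_sign_values: "i < 2 ^ n \<Longrightarrow> z_sign n i C \<in> {1, - 1}"
  using pauli_op_Z_entries[OF set_one_basis_string, of i n C i] by (auto simp: z_sign_def)

lemma kxor_hamiltonian_dim [simp]:
  "dim_row (kxor_hamiltonian n I) = 2 ^ n" "dim_col (kxor_hamiltonian n I) = 2 ^ n"
  by (simp_all add: kxor_hamiltonian_def)

lemma kxor_hamiltonian_carrier: "kxor_hamiltonian n I \<in> carrier_mat (2 ^ n) (2 ^ n)"
  by (simp add: kxor_hamiltonian_def)

text \<open>The eigenbasis moves past each Pauli string separately. Since the Hamiltonian is defined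
  by entries, both sides are first brought to the same average over hyperedges, and then compared
  term by term.\<close>

lemma kxor_hamiltonian_mult_eigenbasis:
  assumes "\<sigma> \<noteq> Pauli_I" "pauli_at I = one_basis_string n \<sigma>"
  defines "U \<equiv> kron_power (eigenbasis \<sigma>) n"
  shows "kxor_hamiltonian n I * U = U * kxor_hamiltonian n (I\<lparr>pauli_at := one_basis_string n Pauli_Z\<rparr>)"
proof -
  let ?N = "2 ^ n :: nat" and ?E = "hyperedges I" and ?b = "\<lambda>C. complex_of_real (sign_at I C)"
  let ?P = "\<lambda>C. pauli_op (one_basis_string n \<sigma> C)" and ?Z = "\<lambda>C. pauli_op (one_basis_string n Pauli_Z C)"
  let ?HZ = "kxor_hamiltonian n (I\<lparr>pauli_at := one_basis_string n Pauli_Z\<rparr>)"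
  have U: "U \<in> carrier_mat ?N ?N" unfolding U_def by (rule kron_power_carrier[OF eigenbasis_carrier(1)])
  have left: "(kxor_hamiltonian n I * U) $$ (i, j) =
      1 / of_nat (card ?E) * (\<Sum>C\<in>?E. (U $$ (i, j) + ?b C * (?P C * U) $$ (i, j)) / 2)"
    if "i < ?N" "j < ?N" for i j
  proof -
    have "(kxor_hamiltonian n I * U) $$ (i, j) = (\<Sum>k<?N. 1 / of_nat (card ?E) * (\<Sum>C\<in>?E.
        ((if i = k then U $$ (k, j) else 0) + ?b C * (?P C $$ (i, k) * U $$ (k, j))) / 2))"
    proof -
      have "(kxor_hamiltonian n I * U) $$ (i, j) = (\<Sum>k<?N. kxor_hamiltonian n I $$ (i, k) * U $$ (k, j))"
        using that U kxor_hamiltonian_carrier[of n I] by (simp add: scalar_prod_def lessThan_atLeast0)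
      also have "\<dots> = (\<Sum>k<?N. 1 / of_nat (card ?E) * (\<Sum>C\<in>?E.
          ((if i = k then 1 else 0) + ?b C * ?P C $$ (i, k)) / 2 * U $$ (k, j)))"
        using that by (intro sum.cong refl)
          (simp add: kxor_hamiltonian_def assms(2) sum_distrib_right del: times_divide_eq_left)
      also have "\<dots> = (\<Sum>k<?N. 1 / of_nat (card ?E) * (\<Sum>C\<in>?E.
          ((if i = k then U $$ (k, j) else 0) + ?b C * (?P C $$ (i, k) * U $$ (k, j))) / 2))"
        by (intro sum.cong refl arg_cong2[where f = "(*)"]) (simp add: field_simps)
      finally show ?thesis .
    qed
    also have "\<dots> = 1 / of_nat (card ?E) * (\<Sum>C\<in>?E. \<Sum>k<?N.
        ((if i = k then U $$ (k, j) else 0) + ?b C * (?P C $$ (i, k) * U $$ (k, j))) / 2)"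
      by (subst sum_distrib_left[symmetric], subst sum.swap) (rule refl)
    also have "\<dots> = 1 / of_nat (card ?E) * (\<Sum>C\<in>?E. (U $$ (i, j) + ?b C * (?P C * U) $$ (i, j)) / 2)"
      using that U by (simp add: scalar_prod_def lessThan_atLeast0 sum.distrib
          flip: sum_distrib_left sum_divide_distrib)
    finally show ?thesis .
  qed
  have right: "(U * ?HZ) $$ (i, j) =
      1 / of_nat (card ?E) * (\<Sum>C\<in>?E. (U $$ (i, j) + ?b C * (U * ?Z C) $$ (i, j)) / 2)"
    if "i < ?N" "j < ?N" for i j
  proof -
    have "(U * ?HZ) $$ (i, j) = (\<Sum>k<?N. 1 / of_nat (card ?E) * (\<Sum>C\<in>?E.
        ((if k = j then U $$ (i, k) else 0) + ?b C * (U $$ (i, k) * ?Z C $$ (k, j))) / 2))"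
    proof -
      have "(U * ?HZ) $$ (i, j) = (\<Sum>k<?N. ?HZ $$ (k, j) * U $$ (i, k))"
        using that U kxor_hamiltonian_carrier[of n "I\<lparr>pauli_at := one_basis_string n Pauli_Z\<rparr>"]
        by (simp add: scalar_prod_def lessThan_atLeast0 mult.commute)
      also have "\<dots> = (\<Sum>k<?N. 1 / of_nat (card ?E) * (\<Sum>C\<in>?E.
          ((if k = j then 1 else 0) + ?b C * ?Z C $$ (k, j)) / 2 * U $$ (i, k)))"
        using that by (intro sum.cong refl)
          (simp add: kxor_hamiltonian_def sum_distrib_right del: times_divide_eq_left)
      also have "\<dots> = (\<Sum>k<?N. 1 / of_nat (card ?E) * (\<Sum>C\<in>?E.
          ((if k = j then U $$ (i, k) else 0) + ?b C * (U $$ (i, k) * ?Z C $$ (k, j))) / 2))"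
        by (intro sum.cong refl arg_cong2[where f = "(*)"]) (simp add: field_simps)
      finally show ?thesis .
    qed
    also have "\<dots> = 1 / of_nat (card ?E) * (\<Sum>C\<in>?E. \<Sum>k<?N.
        ((if k = j then U $$ (i, k) else 0) + ?b C * (U $$ (i, k) * ?Z C $$ (k, j))) / 2)"
      by (subst sum_distrib_left[symmetric], subst sum.swap) (rule refl)
    also have "\<dots> = 1 / of_nat (card ?E) * (\<Sum>C\<in>?E. (U $$ (i, j) + ?b C * (U * ?Z C) $$ (i, j)) / 2)"
      using that U by (simp add: scalar_prod_def lessThan_atLeast0 sum.distrib
          flip: sum_distrib_left sum_divide_distrib)
    finally show ?thesis .
  qed
  show ?thesis
  proof (rule eq_matI)
    fix i j assume "i < dim_row (U * ?HZ)" "j < dim_col (U * ?HZ)"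
    hence "i < ?N" "j < ?N" using U kxor_hamiltonian_carrier by auto
    thus "(kxor_hamiltonian n I * U) $$ (i, j) = (U * ?HZ) $$ (i, j)"
      unfolding left[OF \<open>i < ?N\<close> \<open>j < ?N\<close>] right[OF \<open>i < ?N\<close> \<open>j < ?N\<close>]
      using one_basis_mult_eigenbasis[OF assms(1), of n] by (simp add: U_def)
  qed (use U kxor_hamiltonian_carrier[of n] in auto)
qed

text \<open>Similar matrices have the same characteristic polynomial, and that of a diagonal matrix
  has the diagonal entries as its roots. Here these entries are the fractions of constraints
  satisfied by the assignments \<open>i\<close>.\<close>

lemma eigenvalue_one_basis_iff:
  assumes "\<sigma> \<noteq> Pauli_I" "pauli_at I = one_basis_string n \<sigma>"
  shows "eigenvalue (kxor_hamiltonian n I) (of_real x) \<longleftrightarrow>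
    (\<exists>i<2 ^ n. x = (\<Sum>C\<in>hyperedges I. (1 + sign_at I C * z_sign n i C) / 2) / card (hyperedges I))"
proof -
  let ?N = "2 ^ n :: nat" and ?H = "kxor_hamiltonian n I"
  let ?D = "kxor_hamiltonian n (I\<lparr>pauli_at := one_basis_string n Pauli_Z\<rparr>)"
  let ?v = "\<lambda>i. (\<Sum>C\<in>hyperedges I. (1 + sign_at I C * z_sign n i C) / 2) / card (hyperedges I)"
  define U where "U = kron_power (eigenbasis \<sigma>) n"
  define V where "V = kron_power (eigenbasis_inv \<sigma>) n"
  have carrier: "U \<in> carrier_mat ?N ?N" "V \<in> carrier_mat ?N ?N" "?H \<in> carrier_mat ?N ?N" "?D \<in> carrier_mat ?N ?N"
    unfolding U_def V_def
    by (intro kron_power_carrier eigenbasis_carrier kxor_hamiltonian_carrier)+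
  have UV: "U * V = 1\<^sub>m ?N" "V * U = 1\<^sub>m ?N"
    unfolding U_def V_def
    using kron_power_inverse[OF eigenbasis_carrier eigenbasis_inverse(1)]
      kron_power_inverse[OF eigenbasis_carrier(2,1) eigenbasis_inverse(2)] by simp_all
  have "?H = ?H * (U * V)" using carrier UV by simp
  also have "\<dots> = (?H * U) * V" using carrier by (intro assoc_mult_mat[symmetric])
  also have "?H * U = U * ?D" unfolding U_def by (rule kxor_hamiltonian_mult_eigenbasis[OF assms])
  finally have "similar_mat_wit ?H ?D U V"
    using similar_mat_witI[OF UV _ carrier(3,4,1,2)] by simp
  hence "char_poly ?H = char_poly ?D"
    by (intro char_poly_similar) (auto simp: similar_mat_def)
  moreover have diag: "?D $$ (i, j) = (if i = j then of_real (?v i) else 0)" if "i < ?N" "j < ?N" for i j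
    using that by (auto simp: kxor_hamiltonian_def pauli_op_one_basis_Z of_real_sum)
  moreover have "upper_triangular ?D"
    using diag carrier by (auto simp: upper_triangular_def)
  ultimately have cp: "char_poly ?H = (\<Prod>a\<leftarrow>diag_mat ?D. [:- a, 1:])"
    using char_poly_upper_triangular[OF carrier(4)] by simp
  have "eigenvalue ?H (of_real x) \<longleftrightarrow> of_real x \<in> set (diag_mat ?D)"
    unfolding eigenvalue_root_char_poly[OF carrier(3)] cp
    by (auto simp: poly_prod_list prod_list_zero_iff)
  also have "\<dots> \<longleftrightarrow> (\<exists>i<?N. complex_of_real x = ?D $$ (i, i))"
    using carrier(4) by (auto simp: diag_mat_def)
  also have "\<dots> \<longleftrightarrow> (\<exists>i<?N. x = ?v i)"
  proof -
    have "complex_of_real x = ?D $$ (i, i) \<longleftrightarrow> x = ?v i" if "i < ?N" for i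
      unfolding diag[OF that that] by (simp only: if_True simp_thms of_real_eq_iff)
    thus ?thesis by blast
  qed
  finally show ?thesis .
qed

text \<open>The set of real eigenvalues is the image of a finite nonempty index set, so its
  \<open>Max\<close> is attained and can be bounded value by value.\<close>

lemma lambda_max_one_basis_le:
  fixes \<epsilon> :: real
  assumes "\<sigma> \<noteq> Pauli_I" "pauli_at I = one_basis_string n \<sigma>" "0 < card (hyperedges I)"
    and le: "\<And>i. i < 2 ^ n \<Longrightarrow>
      (\<Sum>C\<in>hyperedges I. sign_at I C * z_sign n i C) \<le> 2 * \<epsilon> * card (hyperedges I)"
  shows "lambda_max (kxor_hamiltonian n I) \<le> 1 / 2 + \<epsilon>"
proof -
  let ?m = "card (hyperedges I)"
  let ?v = "\<lambda>i. (\<Sum>C\<in>hyperedges I. (1 + sign_at I C * z_sign n i C) / 2) / ?m"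
  have eq: "{x. eigenvalue (kxor_hamiltonian n I) (of_real x)} = ?v ` {..<2 ^ n}"
    unfolding eigenvalue_one_basis_iff[OF assms(1,2)] by auto
  have "?v i \<le> 1 / 2 + \<epsilon>" if "i < 2 ^ n" for i
  proof -
    have "?v i = 1 / 2 + (\<Sum>C\<in>hyperedges I. sign_at I C * z_sign n i C) / (2 * ?m)"
      using assms(3) by (simp add: sum_divide_distrib[symmetric] sum.distrib field_simps)
    also have "\<dots> \<le> 1 / 2 + \<epsilon>"
      using le[OF that] assms(3) by (simp add: divide_le_eq mult_ac)
    finally show ?thesis .
  qed
  moreover have "{..<2 ^ n :: nat} \<noteq> {}" by (simp add: lessThan_empty_iff)
  ultimately show ?thesis
    unfolding lambda_max_def eq by (subst Max_le_iff) auto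
qed

section \<open>Random signs\<close>

lemma expectation_uniform_sign: "measure_pmf.expectation (pmf_of_set {1, - 1 :: real}) (\<lambda>x. x * c) = 0"
  by (subst integral_pmf_of_set) auto

text \<open>Hoeffding's inequality for independent centred variables in [-1, 1]. With
  \<open>m = card E\<close>, the deviation \<open>2 * \<epsilon> * m\<close> gives the exponent
  \<open>- 2 * (2 * \<epsilon> * m)\<^sup>2 / (4 * m) = - 2 * \<epsilon>\<^sup>2 *
  m\<close>.\<close>

lemma random_sign_sum_tail:
  fixes z :: "'a \<Rightarrow> real" and \<epsilon> :: real
  assumes "finite E" "E \<noteq> {}" "0 \<le> \<epsilon>" and z: "\<And>C. C \<in> E \<Longrightarrow> z C \<in> {1, - 1}"
  shows "measure_pmf.prob (Pi_pmf E 1 (\<lambda>_. pmf_of_set {1, - 1}))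
      {b. 2 * \<epsilon> * card E \<le> (\<Sum>C\<in>E. b C * z C)} \<le> exp (- 2 * \<epsilon>\<^sup>2 * card E)"
proof -
  let ?P = "Pi_pmf E 1 (\<lambda>_. pmf_of_set {1, - 1 :: real})"
  let ?X = "\<lambda>C b. b C * z C"
  have indep: "prob_space.indep_vars (measure_pmf ?P) (\<lambda>_. borel) ?X E"
    using prob_space.indep_vars_compose2[OF measure_pmf.prob_space_axioms indep_vars_Pi_pmf[OF assms(1)],
        of "\<lambda>C x. x * z C" "\<lambda>_. borel"] by simp
  have mean: "measure_pmf.expectation ?P (?X C) = 0" if "C \<in> E" for C
  proof -
    have "measure_pmf.expectation ?P (?X C) =
        measure_pmf.expectation (map_pmf (\<lambda>b. b C) ?P) (\<lambda>x. x * z C)"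
      by simp
    also have "map_pmf (\<lambda>b. b C) ?P = pmf_of_set {1, - 1}"
      using that by (simp add: Pi_pmf_component[OF assms(1)])
    finally show ?thesis by (simp only: expectation_uniform_sign)
  qed
  interpret Hoeffding_ineq "measure_pmf ?P" E ?X "\<lambda>_. - 1" "\<lambda>_. 1"
    "\<Sum>C\<in>E. measure_pmf.expectation ?P (?X C)"
  proof unfold_locales
    show "prob_space.indep_vars (measure_pmf ?P) (\<lambda>_. borel) ?X E" by (rule indep)
    fix C assume C: "C \<in> E"
    have "b C \<in> {1, - 1}" if "b \<in> set_pmf ?P" for b
      using that C assms(1) by (auto simp: set_Pi_pmf PiE_dflt_def)
    thus "AE b in measure_pmf ?P. ?X C b \<in> {- 1..1}"
      using z[OF C] by (intro AE_pmfI) fastforce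
  qed (use assms in auto)
  have m: "0 < real (card E)" using assms by (simp add: card_gt_0_iff)
  have "measure_pmf.prob ?P {b\<in>space (measure_pmf ?P).
      (\<Sum>C\<in>E. measure_pmf.expectation ?P (?X C)) + 2 * \<epsilon> * card E \<le> (\<Sum>C\<in>E. ?X C b)} \<le>
      exp (- 2 * (2 * \<epsilon> * card E)\<^sup>2 / (\<Sum>C\<in>E. (1 - (- 1))\<^sup>2))"
    using m assms(3) by (intro Hoeffding_ineq_ge) auto
  moreover have "- 2 * (2 * \<epsilon> * card E)\<^sup>2 / (\<Sum>C\<in>E. (1 - (- 1))\<^sup>2) = - 2 * \<epsilon>\<^sup>2 * card E"
    using m by (simp add: power2_eq_square)
  moreover have zero: "(\<Sum>C\<in>E. measure_pmf.expectation ?P (?X C)) = 0"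
    by (rule sum.neutral) (use mean in blast)
  ultimately show ?thesis unfolding zero by simp
qed

text \<open>A bound that holds for each outcome of the first draw survives averaging; it allows the
  hypergraph to be fixed before the signs are drawn.\<close>

lemma measure_bind_pmf_le:
  assumes "\<And>x. x \<in> set_pmf p \<Longrightarrow> measure_pmf.prob (f x) A \<le> B"
  shows "measure_pmf.prob (bind_pmf p f) A \<le> B"
proof -
  obtain x0 where "x0 \<in> set_pmf p" using set_pmf_not_empty[of p] by blast
  hence "0 \<le> B" using assms measure_nonneg order_trans by metis
  have "emeasure (measure_pmf (bind_pmf p f)) A = (\<integral>\<^sup>+x. emeasure (measure_pmf (f x)) A \<partial>measure_pmf p)"
    by simp
  also have "\<dots> \<le> (\<integral>\<^sup>+x. ennreal B \<partial>measure_pmf p)"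
    using assms by (intro nn_integral_mono_AE AE_pmfI) (simp add: measure_pmf.emeasure_eq_measure ennreal_leI)
  also have "\<dots> = ennreal B" by (simp add: measure_pmf.emeasure_space_1)
  finally show ?thesis using \<open>0 \<le> B\<close> by (simp add: measure_pmf.emeasure_eq_measure)
qed

lemma card_uniform_edges: "card (uniform_edges n k) = n choose k"
  unfolding uniform_edges_def using n_subsets[of "{0..<n}" k] by simp

lemma edge_sets_finite_nonempty:
  assumes "m \<le> n choose k"
  shows "finite {E. E \<subseteq> uniform_edges n k \<and> card E = m}" "{E. E \<subseteq> uniform_edges n k \<and> card E = m} \<noteq> {}"
proof -
  show "finite {E. E \<subseteq> uniform_edges n k \<and> card E = m}"
    by (rule finite_subset[of _ "Pow (uniform_edges n k)"]) (auto simp: finite_uniform_edges)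
  show "{E. E \<subseteq> uniform_edges n k \<and> card E = m} \<noteq> {}"
    using obtain_subset_with_card_n[of m "uniform_edges n k"] assms card_uniform_edges by auto
qed

text \<open>With the hypergraph fixed, a large eigenvalue forces a large sign sum at one of the
  \<open>2 ^ n\<close> basis vectors. Each of these events has the Hoeffding bound, and the factor
  \<open>2 ^ n\<close> comes from the union bound.\<close>

lemma prob_lambda_max_large:
  fixes \<epsilon> :: real
  assumes "\<sigma> \<noteq> Pauli_I" "0 < m" "m \<le> n choose k" "0 \<le> \<epsilon>"
  shows "measure_pmf.prob (random_one_basis n k m \<sigma>)
      {I. \<not> lambda_max (kxor_hamiltonian n I) \<le> 1 / 2 + \<epsilon>} \<le> 2 ^ n * exp (- 2 * \<epsilon>\<^sup>2 * m)"
  unfolding random_one_basis_def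
proof (rule measure_bind_pmf_le)
  let ?S = "{E. E \<subseteq> uniform_edges n k \<and> card E = m}"
  fix E assume E: "E \<in> set_pmf (pmf_of_set ?S)"
  hence E: "E \<subseteq> uniform_edges n k" "card E = m"
    using set_pmf_of_set[OF edge_sets_finite_nonempty(2,1)[OF assms(3)]] by auto
  hence fin: "finite E" "E \<noteq> {}"
    using assms(2) finite_subset[OF E(1) finite_uniform_edges] by auto
  let ?P = "Pi_pmf E 1 (\<lambda>_. pmf_of_set {1, - 1 :: real})"
  let ?I = "\<lambda>b. \<lparr>hyperedges = E, pauli_at = one_basis_string n \<sigma>, sign_at = b\<rparr>"
  let ?bad = "{I. \<not> lambda_max (kxor_hamiltonian n I) \<le> 1 / 2 + \<epsilon>}"
  let ?B = "\<lambda>i. {b. 2 * \<epsilon> * card E \<le> (\<Sum>C\<in>E. b C * z_sign n i C)}"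
  have "b \<in> (\<Union>i\<in>{..<2 ^ n}. ?B i)" if "?I b \<in> ?bad" for b
  proof (rule ccontr)
    assume "b \<notin> (\<Union>i\<in>{..<2 ^ n}. ?B i)"
    hence "(\<Sum>C\<in>E. b C * z_sign n i C) \<le> 2 * \<epsilon> * card E" if "i < 2 ^ n" for i
      using that by fastforce
    hence "lambda_max (kxor_hamiltonian n (?I b)) \<le> 1 / 2 + \<epsilon>"
      using fin by (intro lambda_max_one_basis_le[OF assms(1)]) (auto simp: card_gt_0_iff)
    thus False using that by simp
  qed
  hence sub: "?I -` ?bad \<subseteq> (\<Union>i\<in>{..<2 ^ n}. ?B i)" by blast
  have "bind_pmf ?P (\<lambda>b. return_pmf (?I b)) = map_pmf ?I ?P" by (simp add: map_pmf_def)
  hence "measure_pmf.prob (bind_pmf ?P (\<lambda>b. return_pmf (?I b))) ?bad = measure_pmf.prob ?P (?I -` ?bad)"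
    by simp
  also have "\<dots> \<le> measure_pmf.prob ?P (\<Union>i\<in>{..<2 ^ n}. ?B i)"
    using sub by (intro measure_pmf.finite_measure_mono) auto
  also have "\<dots> \<le> (\<Sum>i\<in>{..<2 ^ n}. measure_pmf.prob ?P (?B i))"
    by (intro measure_UNION_le) auto
  also have "\<dots> \<le> (\<Sum>i\<in>{..<2 ^ n :: nat}. exp (- 2 * \<epsilon>\<^sup>2 * card E))"
    using fin assms(4) z_sign_values by (intro sum_mono random_sign_sum_tail) auto
  also have "\<dots> = 2 ^ n * exp (- 2 * \<epsilon>\<^sup>2 * m)" using E by simp
  finally show "measure_pmf.prob (bind_pmf ?P (\<lambda>b. return_pmf (?I b))) ?bad \<le> 2 ^ n * exp (- 2 * \<epsilon>\<^sup>2 * m)" .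
qed

section \<open>Random hypergraphs\<close>

text \<open>Divided by \<open>N choose m\<close>, the left side is the product of the ratios
  \<open>(m - i) / (N - i)\<close> for \<open>i < s\<close>, and each of them is at most
  \<open>m / N\<close>.\<close>

lemma binomial_diff_ratio_le:
  assumes "s \<le> m" "m \<le> N"
  shows "real ((N - s) choose (m - s)) \<le> (real m / real N) ^ s * real (N choose m)"
  using assms(1)
proof (induction s)
  case (Suc s)
  have "(m - s) * ((N - s) choose (m - s)) = (N - s) * ((N - Suc s) choose (m - Suc s))"
    using binomial_absorption[of "m - Suc s" "N - s"] Suc.prems by (simp add: Suc_diff_Suc)
  hence "real (m - s) * real ((N - s) choose (m - s)) = real (N - s) * real ((N - Suc s) choose (m - Suc s))"
    by (metis of_nat_mult)
  hence "real ((N - Suc s) choose (m - Suc s)) = real (m - s) / real (N - s) * real ((N - s) choose (m - s))"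
    using Suc.prems assms(2) by (simp add: field_simps)
  also have "\<dots> \<le> real m / real N * ((real m / real N) ^ s * real (N choose m))"
  proof (rule mult_mono)
    have "real s * real m \<le> real s * real N" using assms(2) by (intro mult_left_mono) auto
    thus "real (m - s) / real (N - s) \<le> real m / real N"
      using Suc.prems assms(2) by (simp add: of_nat_diff frac_le_eq divide_le_eq field_simps)
  qed (use Suc in auto)
  finally show ?case by simp
qed simp

lemma card_supersets:
  assumes "finite U" "T \<subseteq> U"
  shows "card {E. T \<subseteq> E \<and> E \<subseteq> U \<and> card E = m} =
    (if card T \<le> m then (card U - card T) choose (m - card T) else 0)"
proof (cases "card T \<le> m")
  case True
  have fT: "finite T" using assms finite_subset by blast
  have "bij_betw (\<lambda>F. F \<union> T) {F. F \<subseteq> U - T \<and> card F = m - card T} {E. T \<subseteq> E \<and> E \<subseteq> U \<and> card E = m}"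
  proof (rule bij_betw_byWitness[where f' = "\<lambda>E. E - T"])
    show "(\<lambda>F. F \<union> T) ` {F. F \<subseteq> U - T \<and> card F = m - card T} \<subseteq> {E. T \<subseteq> E \<and> E \<subseteq> U \<and> card E = m}"
    proof safe
      fix F assume F: "F \<subseteq> U - T" "card F = m - card T"
      have "card (F \<union> T) = card F + card T"
        using F fT assms by (intro card_Un_disjoint) (auto intro: finite_subset)
      thus "card (F \<union> T) = m" using F True by simp
    qed (use assms in auto)
    show "(\<lambda>E. E - T) ` {E. T \<subseteq> E \<and> E \<subseteq> U \<and> card E = m} \<subseteq> {F. F \<subseteq> U - T \<and> card F = m - card T}"
      using fT by (auto simp: card_Diff_subset)
  qed auto
  hence "card {E. T \<subseteq> E \<and> E \<subseteq> U \<and> card E = m} = card {F. F \<subseteq> U - T \<and> card F = m - card T}"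
    by (simp add: bij_betw_same_card)
  also have "\<dots> = (card U - card T) choose (m - card T)"
    using assms fT by (subst n_subsets) (auto simp: card_Diff_subset)
  finally show ?thesis using True by simp
next
  case False
  have "{E. T \<subseteq> E \<and> E \<subseteq> U \<and> card E = m} = {}"
    using False assms by (auto dest: card_mono[rotated] finite_subset)
  thus ?thesis using False by (simp del: Collect_empty_eq)
qed

text \<open>A fixed \<open>T\<close> lies in a uniform set of size \<open>m\<close> with at most the
  probability it would have if each element were included independently with probability
  \<open>m / card U\<close>.\<close>

lemma prob_uniform_superset_le:
  assumes "finite U" "T \<subseteq> U" "m \<le> card U"
  shows "measure_pmf.prob (pmf_of_set {E. E \<subseteq> U \<and> card E = m}) {E. T \<subseteq> E} \<le>
    (real m / real (card U)) ^ card T"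
proof -
  let ?S = "{E. E \<subseteq> U \<and> card E = m}"
  have fin: "finite ?S" by (rule finite_subset[of _ "Pow U"]) (use assms in auto)
  have cS: "card ?S = card U choose m" using n_subsets[OF assms(1)] .
  hence pos: "0 < card ?S" using assms(3) by (simp add: zero_less_binomial)
  hence ne: "?S \<noteq> {}" by (metis card.empty less_irrefl)
  have "?S \<inter> {E. T \<subseteq> E} = {E. T \<subseteq> E \<and> E \<subseteq> U \<and> card E = m}" by auto
  hence "real (card (?S \<inter> {E. T \<subseteq> E})) \<le> (real m / real (card U)) ^ card T * real (card ?S)"
    unfolding cS using card_supersets[OF assms(1,2)] binomial_diff_ratio_le[OF _ assms(3)] by simp
  thus ?thesis using pos by (simp add: measure_pmf_of_set[OF ne fin] divide_le_eq)
qed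

text \<open>The union can be enlarged to a vertex set with exactly \<open>v\<close> elements.
  Choosing this set first and then \<open>s\<close> of its \<open>k\<close>-subsets counts every
  such \<open>T\<close> at least once.\<close>

lemma card_small_union_le:
  assumes "v \<le> n"
  shows "card {T. T \<subseteq> uniform_edges n k \<and> card T = s \<and> card (\<Union>T) \<le> v} \<le>
    (n choose v) * ((v choose k) choose s)"
proof -
  let ?V = "{V. V \<subseteq> {0..<n} \<and> card V = v}"
  let ?F = "\<lambda>V. {T. T \<subseteq> {C. C \<subseteq> V \<and> card C = k} \<and> card T = s}"
  have fV: "finite ?V" by (rule finite_subset[of _ "Pow {0..<n}"]) auto
  have fF: "finite (?F V)" "card (?F V) = (v choose k) choose s" if "V \<in> ?V" for V
  proof -
    have "finite V" using that finite_subset by blast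
    hence "finite {C. C \<subseteq> V \<and> card C = k}" by (auto intro: finite_subset[of _ "Pow V"])
    moreover have "card {C. C \<subseteq> V \<and> card C = k} = v choose k"
      using n_subsets[OF \<open>finite V\<close>] that by auto
    ultimately show "card (?F V) = (v choose k) choose s" "finite (?F V)"
      using n_subsets[of "{C. C \<subseteq> V \<and> card C = k}" s]
      by (simp_all add: finite_subset[of _ "Pow {C. C \<subseteq> V \<and> card C = k}"] subset_eq)
  qed
  have "{T. T \<subseteq> uniform_edges n k \<and> card T = s \<and> card (\<Union>T) \<le> v} \<subseteq> (\<Union>V\<in>?V. ?F V)"
  proof
    fix T assume "T \<in> {T. T \<subseteq> uniform_edges n k \<and> card T = s \<and> card (\<Union>T) \<le> v}"
    hence T: "T \<subseteq> uniform_edges n k" "card T = s" "card (\<Union>T) \<le> v" by auto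
    have "\<Union>T \<subseteq> {0..<n}" using T(1) by (auto simp: uniform_edges_def)
    then obtain V where V: "\<Union>T \<subseteq> V" "V \<subseteq> {0..<n}" "card V = v"
      using exists_subset_between[of "\<Union>T" v "{0..<n}"] T(3) assms by auto
    hence "T \<in> ?F V" using T by (auto simp: uniform_edges_def)
    thus "T \<in> (\<Union>V\<in>?V. ?F V)" using V by blast
  qed
  hence "card {T. T \<subseteq> uniform_edges n k \<and> card T = s \<and> card (\<Union>T) \<le> v} \<le> card (\<Union>V\<in>?V. ?F V)"
    using fV fF by (intro card_mono) auto
  also have "\<dots> \<le> (\<Sum>V\<in>?V. card (?F V))" by (rule card_UN_le[OF fV])
  also have "\<dots> = (\<Sum>V\<in>?V. (v choose k) choose s)" using fF by (intro sum.cong refl) auto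
  also have "\<dots> = (n choose v) * ((v choose k) choose s)" using n_subsets[of "{0..<n}" v] by simp
  finally show ?thesis .
qed

text \<open>First moment bound: a union bound over the size \<open>s\<close> and over the sets
  \<open>T\<close> of that size, each weighted by its probability of lying in the random
  hypergraph.\<close>

lemma prob_small_union_le:
  fixes v :: "nat \<Rightarrow> nat"
  assumes "m \<le> n choose k" and v: "\<And>s. s \<in> {1..r} \<Longrightarrow> v s \<le> n"
  shows "measure_pmf.prob (pmf_of_set {E. E \<subseteq> uniform_edges n k \<and> card E = m})
      {E. \<exists>T\<subseteq>E. T \<subseteq> uniform_edges n k \<and> card T \<in> {1..r} \<and> card (\<Union>T) \<le> v (card T)} \<le>
    (\<Sum>s\<in>{1..r}. real ((n choose v s) * ((v s choose k) choose s)) * (real m / real (n choose k)) ^ s)"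
proof -
  let ?U = "uniform_edges n k"
  let ?p = "pmf_of_set {E. E \<subseteq> ?U \<and> card E = m}"
  let ?T = "\<lambda>s. {T. T \<subseteq> ?U \<and> card T = s \<and> card (\<Union>T) \<le> v s}"
  have fT: "finite (?T s)" for s
    by (rule finite_subset[of _ "Pow ?U"]) (auto simp: finite_uniform_edges)
  have "{E. \<exists>T\<subseteq>E. T \<subseteq> ?U \<and> card T \<in> {1..r} \<and> card (\<Union>T) \<le> v (card T)} \<subseteq>
      (\<Union>s\<in>{1..r}. \<Union>T\<in>?T s. {E. T \<subseteq> E})" by blast
  hence "measure_pmf.prob ?p {E. \<exists>T\<subseteq>E. T \<subseteq> ?U \<and> card T \<in> {1..r} \<and> card (\<Union>T) \<le> v (card T)} \<le>
      measure_pmf.prob ?p (\<Union>s\<in>{1..r}. \<Union>T\<in>?T s. {E. T \<subseteq> E})"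
    by (intro measure_pmf.finite_measure_mono) auto
  also have "\<dots> \<le> (\<Sum>s\<in>{1..r}. measure_pmf.prob ?p (\<Union>T\<in>?T s. {E. T \<subseteq> E}))"
    by (intro measure_UNION_le) auto
  also have "\<dots> \<le> (\<Sum>s\<in>{1..r}. \<Sum>T\<in>?T s. measure_pmf.prob ?p {E. T \<subseteq> E})"
    using fT by (intro sum_mono measure_UNION_le) auto
  also have "\<dots> \<le> (\<Sum>s\<in>{1..r}. \<Sum>T\<in>?T s. (real m / real (n choose k)) ^ s)"
  proof (intro sum_mono)
    fix s T assume "T \<in> ?T s"
    thus "measure_pmf.prob ?p {E. T \<subseteq> E} \<le> (real m / real (n choose k)) ^ s"
      using prob_uniform_superset_le[OF finite_uniform_edges, of T n k m] assms(1) card_uniform_edges[of n k] by auto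
  qed
  also have "\<dots> = (\<Sum>s\<in>{1..r}. real (card (?T s)) * (real m / real (n choose k)) ^ s)" by simp
  also have "\<dots> \<le> (\<Sum>s\<in>{1..r}. real ((n choose v s) * ((v s choose k) choose s)) * (real m / real (n choose k)) ^ s)"
    using card_small_union_le v by (intro sum_mono mult_right_mono of_nat_mono) auto
  finally show ?thesis .
qed

lemma sum_geometric_le:
  fixes q :: real
  assumes "0 \<le> q" "q \<le> 1 / 2"
  shows "(\<Sum>s\<in>{1..r}. q ^ s) \<le> 2 * q"
proof -
  \<comment> \<open>The subtracted term makes the induction close; its step needs
    \<open>2 * q \<le> 1\<close>.\<close>
  have "(\<Sum>s\<in>{1..r}. q ^ s) \<le> 2 * q - q ^ r * 2 * q"
  proof (induction r)
    case (Suc r)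
    have "q ^ r * q * (2 * q) \<le> q ^ r * q * 1" using assms by (intro mult_left_mono) auto
    thus ?case using Suc by (simp add: algebra_simps)
  qed simp
  also have "\<dots> \<le> 2 * q" using assms by simp
  finally show ?thesis .
qed

section \<open>The union bound for small vertex sets\<close>

text \<open>After division by \<open>fact v\<close>, the left side is a single term of the
  exponential series at \<open>v\<close>.\<close>

lemma power_self_le_fact_exp: "real v ^ v \<le> fact v * exp (real v)"
proof -
  have "real v ^ v / fact v \<le> (\<Sum>i. real v ^ i /\<^sub>R fact i)"
    using sum_le_suminf[OF summable_exp_generic[of "real v"], of "{v}"]
    by (simp add: divide_inverse mult.commute)
  also have "\<dots> = exp (real v)" by (simp add: exp_def)
  finally show ?thesis by (simp add: divide_le_eq mult.commute)
qed

lemma binomial_le_exp_power: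
  assumes "0 < v"
  shows "real (n choose v) \<le> exp (real v) * (real n / real v) ^ v"
proof -
  have "real (n choose v) * fact v \<le> real n ^ v"
    using binomial_fact_pow[of n v] by (metis of_nat_fact of_nat_le_iff of_nat_mult of_nat_power)
  hence le: "real (n choose v) * fact v * exp (real v) \<le> real n ^ v * exp (real v)"
    by (intro mult_right_mono) auto
  have "real (n choose v) * real v ^ v \<le> real (n choose v) * (fact v * exp (real v))"
    by (intro mult_left_mono power_self_le_fact_exp) auto
  also have "\<dots> = real (n choose v) * fact v * exp (real v)" by (simp only: mult.assoc)
  also note le
  also have "real n ^ v * exp (real v) = exp (real v) * real n ^ v" by (rule mult.commute)
  finally have "real (n choose v) * real v ^ v \<le> exp (real v) * real n ^ v" .
  thus ?thesis using assms by (simp add: power_divide pos_le_divide_eq)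
qed

text \<open>Here \<open>v\<close> stands for a rounding down of \<open>x\<close>. The left side is
  \<open>n ^ v * v ^ (k * s - v)\<close>, and replacing \<open>v\<close> by \<open>x\<close> only
  increases it. For \<open>x = s * (k / 2 + \<eta>)\<close> the surplus factor per hyperedge is
  \<open>n\<close> to the power \<open>\<eta>\<close>, which the choice of \<open>\<eta>\<close>
  makes equal to \<open>exp (1 / 2)\<close>.\<close>

lemma vertex_choices_le:
  fixes x \<eta> :: real
  assumes "0 < v" "real v \<le> x" "1 \<le> x" "x \<le> real n" and x: "x = real s * (real k / 2 + \<eta>)"
    and "0 \<le> \<eta>" "\<eta> \<le> real k / 2" "\<eta> * ln (real n) = 1 / 2"
  shows "(real n / real v) ^ v * real v ^ (k * s) \<le>
    (exp (1 / 2) * (real n powr (real k / 2) * (real s * real k) powr (real k / 2))) ^ s"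
proof -
  have n: "0 < real n" "0 < x" using assms by linarith+
  have s: "0 < s" using x n by (cases s) auto
  have k: "0 < k" using assms(1-8) n by (cases k) auto
  have xle: "x \<le> real s * real k" unfolding x using assms(7) by (intro mult_left_mono) auto
  have vks: "v \<le> k * s"
  proof -
    have "real v \<le> real (k * s)" using xle assms(2) by (simp add: mult.commute)
    thus ?thesis by (simp only: of_nat_le_iff)
  qed
  have split: "a ^ (k * s) = a ^ v * a ^ (k * s - v)" for a :: real
    using vks by (simp flip: power_add)
  have "(real n / real v) ^ v * real v ^ (k * s) = real n ^ v * real v ^ (k * s - v)"
    using assms(1) by (simp add: split[of "real v"] power_divide)
  also have "\<dots> \<le> real n ^ v * x ^ (k * s - v)"
    using assms(2) by (intro mult_left_mono power_mono) auto
  also have "\<dots> = (real n / x) ^ v * x ^ (k * s)"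
    using n by (simp add: split[of x] power_divide)
  also have "\<dots> = (real n / x) powr real v * x powr real (k * s)"
    using n powr_realpow[of "real n / x" v] powr_realpow[of x "k * s"] by (simp del: of_nat_mult)
  \<comment> \<open>The base \<open>n / x\<close> is at least 1, so the exponent may grow from
    \<open>v\<close> to \<open>x\<close>.\<close>
  also have "\<dots> \<le> (real n / x) powr x * x powr real (k * s)"
    using n assms(2,4) by (intro mult_right_mono powr_mono) auto
  also have "\<dots> = exp (x * ln (real n) + (real (k * s) - x) * ln x)"
    using n by (simp add: powr_def ln_div algebra_simps flip: exp_add)
  also have "\<dots> \<le> exp (real s * (1 / 2 + real k / 2 * ln (real n) + real k / 2 * ln (real s * real k)))"
  proof -
    have "x * ln (real n) = real s * (real k / 2 * ln (real n) + \<eta> * ln (real n))"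
      by (simp add: x algebra_simps)
    hence 1: "x * ln (real n) = real s * (real k / 2 * ln (real n) + 1 / 2)" using assms(8) by simp
    have "(real (k * s) - x) * ln x \<le> (real s * (real k / 2)) * ln (real s * real k)"
    proof (rule mult_mono)
      show "real (k * s) - x \<le> real s * (real k / 2)" using assms(6) by (simp add: x algebra_simps)
      show "ln x \<le> ln (real s * real k)" using xle n by simp
    qed (use assms(3) in auto)
    thus ?thesis using 1 by (simp add: algebra_simps)
  qed
  also have "\<dots> = (exp (1 / 2 + real k / 2 * ln (real n) + real k / 2 * ln (real s * real k))) ^ s"
    by (rule exp_of_nat_mult)
  also have "exp (1 / 2 + real k / 2 * ln (real n) + real k / 2 * ln (real s * real k)) =
      exp (1 / 2) * (real n powr (real k / 2) * (real s * real k) powr (real k / 2))"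
    using n s k by (simp add: powr_def exp_add)
  finally show ?thesis .
qed

text \<open>The exponent collects \<open>k\<close> from choosing the vertices, 1 from choosing the
  hyperedges and 1/2 from the expansion margin. The power \<open>k / 2\<close> comes from
  \<open>vertex_choices_le\<close>, and \<open>k ^ k\<close> from bounding \<open>n choose k\<close>
  below by \<open>(n / k) ^ k\<close>.\<close>

definition union_const :: "nat \<Rightarrow> real" where
  "union_const k = exp (real k + 3 / 2) * real k powr (real k / 2) * real k ^ k"

text \<open>All powers of \<open>n\<close> cancel against the density of hyperedges, which leaves
  \<open>(s / l)\<close> to the power \<open>k / 2 - 1\<close> per hyperedge. Since
  \<open>s * ln n \<le> l\<close> and \<open>k \<ge> 3\<close>, this is at most
  \<open>1 / ln n\<close> to the power 1/2, and thus tends to 0.\<close>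

lemma small_union_term_le:
  fixes A :: real
  assumes "3 \<le> k" "1 \<le> s" "l \<le> n" "real k \<le> ln (real n)" "real s * ln (real n) \<le> real l"
    and m: "real m \<le> A * real n * (real n / real l) powr (real k / 2 - 1)" and "0 \<le> A"
    and v: "v = nat \<lfloor>real s * (real k / 2 + 1 / (2 * ln (real n)))\<rfloor>"
  shows "v \<le> n"
    and "real ((n choose v) * ((v choose k) choose s)) * (real m / real (n choose k)) ^ s \<le>
      (union_const k * A * (1 / ln (real n)) powr (1 / 2)) ^ s"
proof -
  let ?L = "ln (real n)"
  define \<eta> where "\<eta> = 1 / (2 * ?L)"
  define x where "x = real s * (real k / 2 + \<eta>)"
  have L: "3 \<le> ?L" using assms(1,4) by linarith
  have \<eta>: "0 \<le> \<eta>" "\<eta> \<le> 1 / 2" "\<eta> * ?L = 1 / 2"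
    using L by (auto simp: \<eta>_def field_simps)
  moreover have "1 / 2 \<le> real k / 2" using assms(1) by simp
  ultimately have \<eta>k: "\<eta> \<le> real k / 2" by linarith
  have "0 < real n" using L by (cases n) auto
  hence n: "0 < n" by simp
  have l: "0 < l"
  proof -
    have "0 < real s * ?L" using assms(2) L by simp
    thus ?thesis using assms(5) by (cases l) auto
  qed
  have xle: "x \<le> real s * real k" unfolding x_def using \<eta>k by (intro mult_left_mono) auto
  also have "\<dots> \<le> real s * ?L" using assms(4) by (intro mult_left_mono) auto
  also have "\<dots> \<le> real n" using assms(3,5) by linarith
  finally have xn: "x \<le> real n" .
  have x1: "1 \<le> x"
  proof -
    have "1 * 1 \<le> real s * (real k / 2 + \<eta>)" using assms(1,2) \<eta> by (intro mult_mono) auto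
    thus ?thesis by (simp add: x_def)
  qed
  have vx: "v = nat \<lfloor>x\<rfloor>" by (simp add: v x_def \<eta>_def)
  have vle: "real v \<le> x" using x1 unfolding vx by (simp add: of_nat_floor)
  have v0: "0 < v" using x1 unfolding vx by simp
  show "v \<le> n" using vle xn by linarith
  have kn: "k \<le> n"
  proof -
    have "?L \<le> real n - 1" using \<open>0 < real n\<close> by (rule ln_le_minus_one)
    thus ?thesis using assms(4) by linarith
  qed
  have vk: "real v \<le> real k * real s" using vle xle by (simp add: mult.commute)
  have c1: "real (n choose v) \<le> exp (real k) ^ s * (real n / real v) ^ v"
  proof -
    have "exp (real v) \<le> exp (real s * real k)" using vk by (simp add: mult.commute)
    also have "\<dots> = exp (real k) ^ s" by (rule exp_of_nat_mult)
    finally have "exp (real v) * (real n / real v) ^ v \<le> exp (real k) ^ s * (real n / real v) ^ v"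
      by (intro mult_right_mono) auto
    thus ?thesis using binomial_le_exp_power[OF v0, of n] by linarith
  qed
  have c2: "real ((v choose k) choose s) \<le> (exp 1 / real s) ^ s * real v ^ (k * s)"
  proof -
    have vck: "real (v choose k) \<le> real v ^ k"
    proof -
      have "v choose k \<le> (v choose k) * fact k" by simp
      also have "\<dots> \<le> v ^ k" by (rule binomial_fact_pow)
      finally show ?thesis by (metis of_nat_le_iff of_nat_power)
    qed
    have "real ((v choose k) choose s) \<le> exp (real s) * (real (v choose k) / real s) ^ s"
      using assms(2) by (intro binomial_le_exp_power) auto
    also have "\<dots> \<le> exp (real s) * (real v ^ k / real s) ^ s"
      using vck by (intro mult_left_mono power_mono divide_right_mono) auto
    also have "\<dots> = (exp 1 / real s) ^ s * real v ^ (k * s)"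
      using exp_of_nat_mult[of s "1 :: real"] by (simp add: power_divide power_mult)
    finally show ?thesis .
  qed
  have c3: "(real m / real (n choose k)) ^ s \<le> (real m * real k ^ k / real n ^ k) ^ s"
  proof (intro power_mono)
    have "(real n / real k) ^ k \<le> real (n choose k)" by (rule binomial_ge_n_over_k_pow_k[OF kn])
    moreover have "0 < (real n / real k) ^ k" using n assms(1) by simp
    ultimately have "real m / real (n choose k) \<le> real m / (real n / real k) ^ k"
      by (intro frac_le) auto
    thus "real m / real (n choose k) \<le> real m * real k ^ k / real n ^ k"
      by (simp add: power_divide)
  qed simp
  let ?Y = "exp (1 / 2) * (real n powr (real k / 2) * (real s * real k) powr (real k / 2))"
  have c4: "(real n / real v) ^ v * real v ^ (k * s) \<le> ?Y ^ s"
    by (rule vertex_choices_le[OF v0 vle x1 xn x_def \<eta>(1) \<eta>k \<eta>(3)])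
  have "real ((n choose v) * ((v choose k) choose s)) * (real m / real (n choose k)) ^ s \<le>
      (exp (real k) ^ s * (real n / real v) ^ v) * ((exp 1 / real s) ^ s * real v ^ (k * s)) *
      (real m * real k ^ k / real n ^ k) ^ s"
    unfolding of_nat_mult using c1 c2 c3 by (intro mult_mono) auto
  also have "\<dots> = (exp (real k) ^ s * (exp 1 / real s) ^ s * (real m * real k ^ k / real n ^ k) ^ s) *
      ((real n / real v) ^ v * real v ^ (k * s))"
    by (simp only: mult_ac)
  also have "\<dots> \<le> (exp (real k) ^ s * (exp 1 / real s) ^ s * (real m * real k ^ k / real n ^ k) ^ s) * ?Y ^ s"
    using c4 by (intro mult_left_mono) auto
  also have "\<dots> = (exp (real k) * (exp 1 / real s) * (real m * real k ^ k / real n ^ k) * ?Y) ^ s"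
    by (simp only: power_mult_distrib)
  also have "\<dots> \<le> (union_const k * A * (1 / ?L) powr (1 / 2)) ^ s"
  proof (rule power_mono)
    let ?m = "A * real n * (real n / real l) powr (real k / 2 - 1)"
    have "exp (real k) * (exp 1 / real s) * (real m * real k ^ k / real n ^ k) * ?Y \<le>
        exp (real k) * (exp 1 / real s) * (?m * real k ^ k / real n ^ k) * ?Y"
      using m by (intro mult_right_mono mult_left_mono divide_right_mono) auto
    also have "\<dots> = union_const k * A * (real s / real l) powr (real k / 2 - 1)"
    proof -
      have e: "exp (real k) * exp 1 * exp (1 / 2) = (exp (real k + 3 / 2) :: real)"
        by (simp flip: exp_add)
      have nk: "real n ^ k = real n powr (real k / 2) * (real n * real n powr (real k / 2 - 1))"
        using n by (simp add: powr_mult_base powr_realpow flip: powr_add)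
      have nl: "(real n / real l) powr (real k / 2 - 1) =
          real n powr (real k / 2 - 1) / real l powr (real k / 2 - 1)"
        using n l by (simp add: powr_divide)
      have sl: "(real s / real l) powr (real k / 2 - 1) =
          real s powr (real k / 2) / real s / real l powr (real k / 2 - 1)"
        using assms(2) l by (simp add: powr_divide powr_diff)
      have sk: "(real s * real k) powr (real k / 2) = real s powr (real k / 2) * real k powr (real k / 2)"
        by (simp add: powr_mult)
      \<comment> \<open>A field identity to be used with \<open>x\<close>, \<open>y\<close> the
        powers of \<open>n\<close> with exponents \<open>k / 2\<close> and \<open>k / 2 - 1\<close>,
        \<open>z\<close> that of \<open>l\<close> with exponent \<open>k / 2 - 1\<close>, and
        \<open>d\<close>, \<open>e\<close> those of \<open>s\<close> and \<open>k\<close> with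
        exponent \<open>k / 2\<close>.\<close>
      have cancel: "x1 * (x2 / S) * (A * N * (y / z) * K / (x * (N * y))) * (x3 * (x * (d * e))) =
          x1 * x2 * x3 * e * K * A * (d / S / z)"
        if "S \<noteq> 0" "N \<noteq> 0" "x \<noteq> 0" "y \<noteq> 0" "z \<noteq> 0" for x1 x2 x3 S N K x y z d e :: real
        using that by (simp add: field_simps)
      show ?thesis
        unfolding union_const_def e[symmetric] nk nl sl sk
        using n l assms(2) by (intro cancel) auto
    qed
    also have "\<dots> \<le> union_const k * A * (1 / ?L) powr (1 / 2)"
    proof (rule mult_left_mono)
      have "real s / real l \<le> 1 / ?L" using assms(5) l L by (simp add: field_simps)
      hence "(real s / real l) powr (real k / 2 - 1) \<le> (1 / ?L) powr (real k / 2 - 1)"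
        using assms(1) by (intro powr_mono2) auto
      also have "\<dots> \<le> (1 / ?L) powr (1 / 2)"
        using L assms(1) by (intro powr_mono') auto
      finally show "(real s / real l) powr (real k / 2 - 1) \<le> (1 / ?L) powr (1 / 2)" .
      show "0 \<le> union_const k * A" using assms(7) by (simp add: union_const_def)
    qed
    finally show "exp (real k) * (exp 1 / real s) * (real m * real k ^ k / real n ^ k) * ?Y \<le>
        union_const k * A * (1 / ?L) powr (1 / 2)" .
  qed simp
  finally show "real ((n choose v) * ((v choose k) choose s)) * (real m / real (n choose k)) ^ s \<le>
      (union_const k * A * (1 / ?L) powr (1 / 2)) ^ s" .
qed

text \<open>If expansion fails, some nonempty \<open>T\<close> with at most \<open>r\<close>
  hyperedges covers too few vertices. The first moment bound over these sets is dominated by a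
  geometric series with ratio at most 1/2.\<close>

lemma prob_not_expanding_le:
  fixes A :: real
  assumes "3 \<le> k" "l \<le> n" "real k \<le> ln (real n)" "m \<le> n choose k" "2 \<le> r" "real r * ln (real n) \<le> real l"
    and m: "real m \<le> A * real n * (real n / real l) powr (real k / 2 - 1)" and "0 \<le> A"
    and q: "union_const k * A * (1 / ln (real n)) powr (1 / 2) \<le> 1 / 2"
    and D: "real D \<le> real r / (2 * ln (real n))"
  shows "measure_pmf.prob (pmf_of_set {E. E \<subseteq> uniform_edges n k \<and> card E = m}) {E. \<not> expanding E r D} \<le>
    2 * (union_const k * A * (1 / ln (real n)) powr (1 / 2))"
proof -
  let ?q = "union_const k * A * (1 / ln (real n)) powr (1 / 2)"
  let ?\<eta> = "1 / (2 * ln (real n))"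
  let ?p = "pmf_of_set {E. E \<subseteq> uniform_edges n k \<and> card E = m}"
  define v where "v s = nat \<lfloor>real s * (real k / 2 + ?\<eta>)\<rfloor>" for s
  have L: "0 \<le> ln (real n)" using assms(3) by linarith
  have q0: "0 \<le> ?q" using assms(8) by (simp add: union_const_def)
  have sl: "real s * ln (real n) \<le> real l" if "s \<in> {1..r}" for s
  proof -
    have "real s * ln (real n) \<le> real r * ln (real n)" using that L by (intro mult_right_mono) auto
    thus ?thesis using assms(6) by linarith
  qed
  note term_le = small_union_term_le[OF assms(1) _ assms(2,3) sl m assms(8) v_def]
  let ?B = "{E. \<exists>T\<subseteq>E. T \<subseteq> uniform_edges n k \<and> card T \<in> {1..r} \<and> card (\<Union>T) \<le> v (card T)}"
  have bad: "E \<in> ?B" if E: "E \<subseteq> uniform_edges n k" and not: "\<not> expanding E r D" for E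
  proof (rule ccontr)
    assume notB: "E \<notin> ?B"
    have fin: "finite E" using E finite_uniform_edges finite_subset by blast
    have "expanding E r D"
    proof (rule expandingI[OF fin _ assms(5)])
      show "finite C \<and> card C = k" if "C \<in> E" for C
        using that E by (auto simp: uniform_edges_def intro: finite_subset)
      show "0 \<le> ?\<eta>" using L by simp
      show "real D \<le> real r * ?\<eta>" using D by simp
      fix T assume T: "T \<subseteq> E" "T \<noteq> {}" "card T \<le> r"
      have "finite T" using T(1) fin by (rule finite_subset)
      hence "card T \<in> {1..r}" using T by (simp add: Suc_le_eq card_gt_0_iff)
      hence "v (card T) < card (\<Union>T)" using notB T E by force
      \<comment> \<open>The number of covered vertices is an integer, so exceeding the rounded
        threshold means exceeding the real one.\<close>
      hence "\<lfloor>real (card T) * (real k / 2 + ?\<eta>)\<rfloor> < int (card (\<Union>T))" by (simp add: v_def)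
      thus "real (card T) * (real k / 2 + ?\<eta>) < real (card (\<Union>T))"
        by (metis floor_less_iff of_int_of_nat_eq)
    qed
    thus False using not by simp
  qed
  let ?S = "{E. E \<subseteq> uniform_edges n k \<and> card E = m}"
  note S = edge_sets_finite_nonempty[OF assms(4)]
  have "measure_pmf.prob ?p {E. \<not> expanding E r D} \<le> measure_pmf.prob ?p ?B"
  proof (rule measure_pmf.finite_measure_mono_AE)
    show "AE E in measure_pmf ?p. E \<in> {E. \<not> expanding E r D} \<longrightarrow> E \<in> ?B"
      using bad by (intro AE_pmfI) (auto simp: set_pmf_of_set[OF S(2,1)])
  qed simp
  also have "\<dots> \<le> (\<Sum>s\<in>{1..r}. real ((n choose v s) * ((v s choose k) choose s)) * (real m / real (n choose k)) ^ s)"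
    using term_le(1) by (intro prob_small_union_le assms(4)) auto
  also have "\<dots> \<le> (\<Sum>s\<in>{1..r}. ?q ^ s)"
    using term_le(2) by (intro sum_mono) auto
  also have "\<dots> \<le> 2 * ?q" by (rule sum_geometric_le[OF q0 q])
  finally show ?thesis .
qed

section \<open>Choice of the expansion parameters\<close>

lemma nat_floor_bounds:
  fixes y :: real
  assumes "0 \<le> y"
  shows "real (nat \<lfloor>y\<rfloor>) \<le> y" "y < real (nat \<lfloor>y\<rfloor>) + 1"
  using assms by linarith+

text \<open>For large \<open>l\<close>, take \<open>r\<close> and \<open>D\<close> as the integer
  parts of \<open>l / ln n\<close> and \<open>r / (2 * ln n)\<close>. Each rounding costs at most a
  factor 2, which together with the 2 in the denominator gives the constant 1/8. For smaller
  \<open>l\<close> the required degree is below 1, and every hypergraph in question already expands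
  with \<open>r = 2\<close> and \<open>D = 1\<close>.\<close>

lemma exists_expansion_parameters:
  fixes A :: real
  assumes "3 \<le> k" "l \<le> n" "real k \<le> ln (real n)" "m \<le> n choose k"
    and m: "real m \<le> A * real n * (real n / real l) powr (real k / 2 - 1)" and "0 \<le> A"
    and q: "union_const k * A * (1 / ln (real n)) powr (1 / 2) \<le> 1 / 2"
  obtains r D where "1 / 8 * real l / ln (real n) ^ 2 \<le> real D"
    and "measure_pmf.prob (pmf_of_set {E. E \<subseteq> uniform_edges n k \<and> card E = m}) {E. \<not> expanding E r D} \<le>
      2 * (union_const k * A * (1 / ln (real n)) powr (1 / 2))"
proof (cases "4 * ln (real n) ^ 2 \<le> real l")
  case True
  let ?L = "ln (real n)"
  have L: "3 \<le> ?L" using assms(1,3) by linarith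
  define r where "r = nat \<lfloor>real l / ?L\<rfloor>"
  define D where "D = nat \<lfloor>real r / (2 * ?L)\<rfloor>"
  have lL: "4 * ?L \<le> real l / ?L" using True L by (simp add: pos_le_divide_eq power2_eq_square mult_ac)
  have r: "real r \<le> real l / ?L" "real l / ?L < real r + 1"
    unfolding r_def using nat_floor_bounds[of "real l / ?L"] L by simp_all
  have "12 \<le> real l / ?L" using lL L by linarith
  hence "11 < real r" using r by linarith
  hence r2: "2 \<le> r" by simp
  have half: "real l / ?L \<le> 2 * real r" using r lL L by linarith
  have D: "real D \<le> real r / (2 * ?L)" "real r / (2 * ?L) < real D + 1"
    unfolding D_def using nat_floor_bounds[of "real r / (2 * ?L)"] L by simp_all
  have quarter: "real l / (4 * ?L ^ 2) \<le> real r / (2 * ?L)"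
    using half L by (simp add: field_simps power2_eq_square)
  \<comment> \<open>This is what the case distinction provides: \<open>r / (2 * ln n)\<close> is at
    least 1, so its integer part \<open>D\<close> is positive and loses at most half.\<close>
  have "1 \<le> real l / (4 * ?L ^ 2)" using True L by (simp add: pos_le_divide_eq)
  hence "0 < real D" using quarter D by linarith
  hence "1 \<le> real D" by simp
  hence "real r / (2 * ?L) \<le> 2 * real D" using D by linarith
  hence "1 / 8 * real l / ?L ^ 2 \<le> real D" using quarter by simp
  moreover have "real r * ?L \<le> real l" using r L by (simp add: pos_le_divide_eq)
  ultimately show ?thesis
    using that prob_not_expanding_le[OF assms(1-4) r2 _ m assms(6) q D(1)] by blast
next
  case False
  let ?S = "{E. E \<subseteq> uniform_edges n k \<and> card E = m}"
  have L: "3 \<le> ln (real n)" using assms(1,3) by linarith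
  note S = edge_sets_finite_nonempty[OF assms(4)]
  have "expanding E 2 1" if "E \<in> ?S" for E
  proof (rule expanding_2_1)
    show "finite E" using that finite_uniform_edges finite_subset by blast
    show "finite C \<and> card C = k" if "C \<in> E" for C
      using that \<open>E \<in> ?S\<close> by (auto simp: uniform_edges_def intro: finite_subset)
  qed (use assms(1) in simp)
  hence "measure_pmf.prob (pmf_of_set ?S) {E. \<not> expanding E 2 1} = 0"
    by (auto simp: measure_pmf_zero_iff set_pmf_of_set[OF S(2,1)])
  moreover have "0 \<le> union_const k * A * (1 / ln (real n)) powr (1 / 2)"
    using assms(6) by (simp add: union_const_def)
  moreover have "1 / 8 * real l / ln (real n) ^ 2 \<le> real 1"
    using False L by (simp add: divide_le_eq)
  ultimately show ?thesis using that[of 1 2] by simp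
qed

section \<open>Combining the two failure events\<close>

lemma map_hyperedges_random_one_basis:
  "map_pmf hyperedges (random_one_basis n k m \<sigma>) = pmf_of_set {E. E \<subseteq> uniform_edges n k \<and> card E = m}"
  by (simp add: random_one_basis_def map_bind_pmf bind_return_pmf')

lemma pauli_at_random_one_basis:
  "I \<in> set_pmf (random_one_basis n k m \<sigma>) \<Longrightarrow> pauli_at I = one_basis_string n \<sigma>"
  by (auto simp: random_one_basis_def)

lemma not_ncsos_certifies_less:
  assumes "pseudo_expectation n D E" "E H = 1"
  shows "\<not> ncsos_certifies_less n D H 1"
proof -
  have "ereal (Re (E H)) \<le> ncsos_value n D H"
    unfolding ncsos_value_def using assms(1) by (intro SUP_upper) auto
  thus ?thesis using assms(2) by (simp add: ncsos_certifies_less_def one_ereal_def not_less)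
qed

text \<open>Outside two failure events, a large eigenvalue and a lack of expansion, the derived
  signs give a pseudo-expectation with value 1. The error term \<open>k / ln n\<close> covers the
  small \<open>n\<close> to which the expansion bound does not apply.\<close>

lemma success_probability:
  fixes A \<epsilon> :: real and \<sigma> :: pauli
  assumes \<sigma>: "\<sigma> \<noteq> Pauli_I" and k: "3 \<le> k" and l: "k \<le> l" "l \<le> n" and \<epsilon>: "0 < \<epsilon>" and A: "0 \<le> A"
    and mn: "m \<le> n choose k" and lower: "real n \<le> \<epsilon>\<^sup>2 * real m"
    and upper: "real m \<le> A * real n * (real n / real l) powr (real k / 2 - 1)"
  defines "q \<equiv> union_const k * A * (1 / ln (real n)) powr (1 / 2)"
  shows "1 - ((2 * exp (- 2)) ^ n + 2 * q + real k / ln (real n)) \<le>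
    measure_pmf.prob (random_one_basis n k m \<sigma>)
      {I. lambda_max (kxor_hamiltonian n I) \<le> 1 / 2 + \<epsilon> \<and>
          (\<exists>D :: nat. 1 / 8 * real l / ln (real n) ^ 2 \<le> real D \<and>
             \<not> ncsos_certifies_less n D (kxor_hamiltonian n I) 1 \<and>
             (k \<le> D \<longrightarrow>
               (\<exists>E. pseudo_expectation n D E \<and> E (kxor_hamiltonian n I) = 1)))}"
    (is "_ \<le> measure_pmf.prob ?p ?G")
proof -
  have n3: "3 \<le> n" using k l by linarith
  have L: "0 < ln (real n)" using n3 by simp
  have q0: "0 \<le> q" using A by (simp add: q_def union_const_def)
  show ?thesis
  \<comment> \<open>In the complementary case the error terms already sum to at least 1, and the
    claimed lower bound is not positive.\<close>
  proof (cases "q \<le> 1 / 2 \<and> real k \<le> ln (real n)")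
    case False
    have "1 \<le> 2 * q \<or> 1 \<le> real k / ln (real n)"
      using False L by (auto simp: le_divide_eq)
    moreover have "0 \<le> real k / ln (real n)" "0 \<le> (2 * exp (- 2) :: real) ^ n" using L by auto
    ultimately have "1 \<le> (2 * exp (- 2)) ^ n + 2 * q + real k / ln (real n)" using q0 by linarith
    thus ?thesis using measure_nonneg[of "measure_pmf ?p" ?G] by linarith
  next
    case True
    have m0: "0 < m" using lower n3 by (cases m) auto
    obtain r D where D: "1 / 8 * real l / ln (real n) ^ 2 \<le> real D"
      and exp: "measure_pmf.prob (pmf_of_set {E. E \<subseteq> uniform_edges n k \<and> card E = m})
        {E. \<not> expanding E r D} \<le> 2 * q"
      using exists_expansion_parameters[OF k l(2) _ mn upper A] True unfolding q_def by blast
    let ?B1 = "{I. \<not> lambda_max (kxor_hamiltonian n I) \<le> 1 / 2 + \<epsilon>}"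
    let ?B2 = "{I. \<not> expanding (hyperedges I) r D}"
    have B1: "measure_pmf.prob ?p ?B1 \<le> (2 * exp (- 2)) ^ n"
    proof -
      have "measure_pmf.prob ?p ?B1 \<le> 2 ^ n * exp (- 2 * \<epsilon>\<^sup>2 * real m)"
        by (rule prob_lambda_max_large[OF \<sigma> m0 mn]) (use \<epsilon> in simp)
      \<comment> \<open>Since \<open>\<epsilon>\<^sup>2 * m\<close> is at least \<open>n\<close>,
        the Hoeffding exponent outweighs the \<open>2 ^ n\<close> basis vectors.\<close>
      also have "\<dots> \<le> 2 ^ n * exp (real n * (- 2))" using lower by simp
      also have "\<dots> = (2 * exp (- 2)) ^ n" by (simp only: exp_of_nat_mult power_mult_distrib)
      finally show ?thesis .
    qed
    have B2: "measure_pmf.prob ?p ?B2 \<le> 2 * q"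
    proof -
      have "measure_pmf.prob ?p ?B2 =
          measure_pmf.prob (map_pmf hyperedges ?p) {E. \<not> expanding E r D}"
        by (simp add: vimage_def)
      thus ?thesis using exp by (simp only: map_hyperedges_random_one_basis)
    qed
    have good: "I \<in> ?G" if I: "I \<in> set_pmf ?p" "I \<notin> ?B1" "I \<notin> ?B2" for I
    proof -
      note inst = random_one_basis_is_instance[OF mn I(1)]
      have "hyperedges I \<noteq> {}" using inst(2) m0 by auto
      then obtain E where E: "pseudo_expectation n D E" "E (kxor_hamiltonian n I) = 1"
        using exists_pseudo_expectation[OF \<sigma>, of I r D n k] I(3) inst(1)
          pauli_at_random_one_basis[OF I(1)]
        by (auto simp: hamiltonian_kxor_def)
      thus ?thesis using I(2) D not_ncsos_certifies_less[OF E] by blast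
    qed
    \<comment> \<open>Every instance in the support is good or lies in one of the two failure
      events.\<close>
    have "1 = measure_pmf.prob ?p (?G \<union> (?B1 \<union> ?B2))"
      by (rule sym, subst measure_pmf.prob_eq_1) (use good in \<open>auto intro!: AE_pmfI\<close>)
    also have "\<dots> \<le> measure_pmf.prob ?p ?G + measure_pmf.prob ?p (?B1 \<union> ?B2)"
      by (intro measure_Un_le) auto
    also have "measure_pmf.prob ?p (?B1 \<union> ?B2) \<le> measure_pmf.prob ?p ?B1 + measure_pmf.prob ?p ?B2"
      by (intro measure_Un_le) auto
    finally have "1 \<le> measure_pmf.prob ?p ?G + ((2 * exp (- 2)) ^ n + 2 * q)"
      using B1 B2 by linarith
    moreover have "0 \<le> real k / ln (real n)" using L by simp
    ultimately show ?thesis by linarith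
  qed
qed

theorem theorem1p4:
  shows "\<forall>k :: nat. 3 \<le> k \<longrightarrow>
    (\<exists>C0 > (0 :: real). \<exists>a :: nat.
      \<forall>C1 C2 \<epsilon> :: real. C0 \<le> C1 \<longrightarrow> C1 \<le> C2 \<longrightarrow> 0 < \<epsilon> \<longrightarrow>
      (\<exists>c > (0 :: real). \<exists>\<delta> :: nat \<Rightarrow> real. \<delta> \<longlonglongrightarrow> 0 \<and>
        (\<forall>n l m :: nat. \<forall>\<sigma> \<in> {Pauli_X, Pauli_Y, Pauli_Z}.
          k \<le> l \<longrightarrow> l \<le> n \<longrightarrow>
          C1 * real n * (real n / real l) powr (real k / 2 - 1) / \<epsilon>\<^sup>2 \<le> real m \<longrightarrow>
          real m \<le> C2 * real n * (real n / real l) powr (real k / 2 - 1) / \<epsilon>\<^sup>2 \<longrightarrow>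
          m \<le> n choose k \<longrightarrow>
          1 - \<delta> n \<le> measure_pmf.prob (random_one_basis n k m \<sigma>)
            {I. lambda_max (kxor_hamiltonian n I) \<le> 1 / 2 + \<epsilon> \<and>
                (\<exists>D :: nat. c * real l / ln (real n) ^ a \<le> real D \<and>
                   \<not> ncsos_certifies_less n D (kxor_hamiltonian n I) 1 \<and>
                   (k \<le> D \<longrightarrow>
                     (\<exists>E. pseudo_expectation n D E \<and> E (kxor_hamiltonian n I) = 1)))})))"
proof (intro allI impI, rule exI[of _ 1], intro conjI exI[of _ "2 :: nat"] allI impI, goal_cases)
  case 1
  show ?case by simp
next
  case (2 k C1 C2 \<epsilon>)
  \<comment> \<open>The dependence on \<open>\<epsilon>\<close> is moved into the density constant
    \<open>A\<close>; \<open>\<delta>\<close> is the total error of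
    \<open>success_probability\<close> and depends on \<open>n\<close> only, not on
    \<open>l\<close>, \<open>m\<close> or \<open>\<sigma>\<close>.\<close>
  define A where "A = C2 / \<epsilon>\<^sup>2"
  define \<delta> where "\<delta> n = (2 * exp (- 2)) ^ n +
    2 * (union_const k * A * (1 / ln (real n)) powr (1 / 2)) + real k / ln (real n)" for n :: nat
  have A: "0 \<le> A" using 2 by (simp add: A_def)
  have e2: "2 * exp (- 2) < (1 :: real)"
  proof -
    have "1 + 1 \<le> exp (1 :: real)" by (rule exp_ge_add_one_self)
    hence "2 * 2 \<le> exp 1 * exp (1 :: real)" by (intro mult_mono) auto
    also have "\<dots> = exp 2" by (simp flip: exp_add)
    finally have "2 < exp (2 :: real)" by simp
    thus ?thesis by (simp add: exp_minus field_simps)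
  qed
  have \<delta>: "\<delta> \<longlonglongrightarrow> 0"
  proof -
    have 1: "(\<lambda>n. (2 * exp (- 2)) ^ n) \<longlonglongrightarrow> (0 :: real)"
      using e2 by (intro LIMSEQ_realpow_zero) auto
    have 2: "(\<lambda>n. (1 / ln (real n)) powr (1 / 2)) \<longlonglongrightarrow> 0" by real_asymp
    have 3: "(\<lambda>n. 1 / ln (real n)) \<longlonglongrightarrow> 0" by real_asymp
    have "(\<lambda>n. (2 * exp (- 2)) ^ n + 2 * (union_const k * A * (1 / ln (real n)) powr (1 / 2)) +
        real k * (1 / ln (real n))) \<longlonglongrightarrow> 0 + 2 * (union_const k * A * 0) + real k * 0"
      by (intro tendsto_intros 1 2 3)
    thus ?thesis by (simp add: \<delta>_def[abs_def])
  qed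
  show ?case
  \<comment> \<open>The constant 1/8 and the exponent 2 of the logarithm are those of
    \<open>exists_expansion_parameters\<close>.\<close>
  proof (rule exI[of _ "1 / 8 :: real"], intro conjI exI[of _ \<delta>] allI ballI impI, goal_cases)
    case 1
    show ?case by simp
  next
    case 2
    show ?case by (rule \<delta>)
  next
    case (3 n l m \<sigma>)
    \<comment> \<open>The density factor is at least 1 because \<open>l \<le> n\<close>. Hence
      \<open>C1 \<ge> 1\<close> already gives \<open>\<epsilon>\<^sup>2 * m \<ge> n\<close>, which
      is why the constant \<open>C0 = 1\<close> suffices.\<close>
    have "1 \<le> (real n / real l) powr (real k / 2 - 1)"
      using 2 3 by (intro ge_one_powr_ge_zero) auto
    hence "1 * real n * 1 \<le> C1 * real n * (real n / real l) powr (real k / 2 - 1)"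
      using 2 by (intro mult_mono) auto
    also have "\<dots> \<le> \<epsilon>\<^sup>2 * real m"
      using 2 3 by (simp add: pos_divide_le_eq mult.commute)
    finally have lower: "real n \<le> \<epsilon>\<^sup>2 * real m" by simp
    have upper: "real m \<le> A * real n * (real n / real l) powr (real k / 2 - 1)"
      using 3 by (simp add: A_def)
    have "\<sigma> \<noteq> Pauli_I" using 3 by auto
    thus ?case
      unfolding \<delta>_def using 2 3 A lower upper by (intro success_probability) auto
  qed
qed

end
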